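(* In the noise-limited network described in the context, let $R_b$ be the rate of the transmitted codewords, $R_s$ the rate of the confidential information, $R_e=R_b-R_s$, $T_c=2^{R_b}-1$, $T_e=2^{R_e}-1$, and let $$\mathrm{SNR}_U=\frac{P_tM_sL(x^*,o)h_{x^*o}}{N_0},\qquad \mathrm{SNR}_{E_z}=\frac{P_tG_b(\theta_z)L(x^*,z)g_{x^*z}}{N_0}\quad(z\in\Phi_E).$$ For the non-colluding eavesdroppers case, the connection probability $p_{con}=\Pr(\mathrm{SNR}_U\ge T_c)$ is $$p_{con}=A_L\int_0^D\frac{\Gamma\left(N_L,\frac{N_0T_cr^{\alpha_L}}{P_tM_sC_L}\right)}{\Gamma(N_L)}f_{r_L}(r)\,dr+A_N\int_0^{+\infty}\frac{\Gamma\left(N_N,\frac{N_0T_cr^{\alpha_N}}{P_tM_sC_N}\right)}{\Gamma(N_N)}f_{r_N}(r)\,dr,$$ and the secrecy probability $p_{sec,n}=\Pr\left(\max_{z\in\Phi_E}\mathrm{SNR}_{E_z}\le T_e\right)$ is $$p_{sec,n}=\exp\left(-\Lambda_E\left(0,\frac{1}{T_eN_0}\right)\right),$$ where, for $t>0$, $$\Lambda_E(0,t)=2\pi\lambda_E\left(\sum_{j\in\{L,N\}}q_j\big(\Omega_{j,\mathrm{in}}(M_s,t)+\Omega_{j,\mathrm{in}}(m_s,t)\big)+\Omega_{N,\mathrm{out}}(M_s,t)+\Omega_{N,\mathrm{out}}(m_s,t)\right),$$ with $q_L=C$, $q_N=1-C$ and, for $V\in\{M_s,m_s\}$, $$\Omega_{j,\mathrm{in}}(V,t)=\mathrm{Pr}_{G_b}(V)\frac{(VC_jt)^{2/\alpha_j}}{\alpha_j}\sum_{m=0}^{N_j-1}\frac{\gamma\left(m+\frac{2}{\alpha_j},\frac{D^{\alpha_j}}{VC_jt}\right)}{m!},\qquad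 \Omega_{j,\mathrm{out}}(V,t)=\mathrm{Pr}_{G_b}(V)\frac{(VC_jt)^{2/\alpha_j}}{\alpha_j}\sum_{m=0}^{N_j-1}\frac{\Gamma\left(m+\frac{2}{\alpha_j},\frac{D^{\alpha_j}}{VC_jt}\right)}{m!}.$$
   Context: Notation: $\gamma(\cdot,\cdot)$ and $\Gamma(\cdot,\cdot)$ are the lower and upper incomplete gamma functions, $\Gamma(\cdot)$ is the gamma function; $\mathrm{gamma}(k,1)$ is the gamma distribution with shape $k$ and scale $1$; $o$ is the origin of $\mathbb{R}^2$. $P_t>0$ is the transmit power and $N_0>0$ the noise power. Base stations (BSs). BS locations form a homogeneous Poisson point process (PPP) $\Phi_B$ on $\mathbb{R}^2$ of intensity $\lambda_B>0$. The typical user is at $o$. Blockage. Let $D>0$ and $0\le C\le 1$. Every link (BS to user, or BS to eavesdropper) of length $r$ is line-of-sight (LOS) with probability $C$ if $r\le D$ and $0$ if $r>D$, and non-line-of-sight (NLOS) otherwise, independently over links. $\Phi_L$ and $\Phi_N$ are the sets of BSs whose link to $o$ is LOS, respectively NLOS; they are independent PPPs. Path loss. $L(x,y)=C_L\|x-y\|^{-\alpha_L}$ if the link $x\to y$ is LOS and $L(x,y)=C_N\|x-y\|^{-\alpha_N}$ if it is NLOS, where $C_L>C_N>0$ and $0<\alpha_L<\alpha_N$. Association. The typical user is served by the BS $x^*=\arg\max_{x\in\Phi_B}L(x,o)$. For $j\in\{L,N\}$, $A_j=\Pr(x^*\in\Phi_j)$, $r_j$ is the distance $\|x^*\|$ conditioned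 on $x^*\in\Phi_j$, and $f_{r_j}$ is its probability density (a term with $A_j=0$ is read as $0$). Eavesdroppers. Eavesdropper locations form a homogeneous PPP $\Phi_E$ on $\mathbb{R}^2$ of intensity $\lambda_E>0$, independent of $\Phi_B$. Non-colluding means that each eavesdropper decodes on its own. Fading. $h_{x^*o}$ (user) and $g_{x^*z}$ (eavesdropper at $z$) are small-scale power gains, mutually independent and independent of everything else given the link states, distributed as $\mathrm{gamma}(N_L,1)$ if the link is LOS and $\mathrm{gamma}(N_N,1)$ if it is NLOS, with $N_L,N_N$ positive integers. Antenna gain. $M_s$ and $m_s$ are the (positive) main-lobe and side-lobe array gains and $\theta_b$ (degrees) is the main-lobe beam width parameter. The serving BS has gain $M_s$ towards its user. Towards an eavesdropper $z$ its gain is an independent random variable $G_b(\theta_z)$ equal to $M_s$ with probability $\mathrm{Pr}_{G_b}(M_s)=\theta_b/180$ and to $m_s$ with probability $\mathrm{Pr}_{G_b}(m_s)=(180-\theta_b)/180$.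
   Formalization: The secrecy probability is proved as exp(-Λ_E(0, P_t/(T_e N_0))) for every P_t>0; the printed argument 1/(T_e N_0) omits P_t and is correct only when P_t=1, a case stated separately. Rates satisfy 0≤R_s<R_b and 0≤θ_b≤180. *)

theory Defs
  imports "HOL-Probability.Probability"
begin

section \<open>Incomplete gamma functions and the gamma distribution\<close>

definition lower_Gamma :: "real \<Rightarrow> real \<Rightarrow> real" where
  "lower_Gamma s x = (LBINT t:{0..x}. t powr (s - 1) * exp (- t))"

definition upper_Gamma :: "real \<Rightarrow> real \<Rightarrow> real" where
  "upper_Gamma s x = (LBINT t:{x..}. t powr (s - 1) * exp (- t))"

text \<open>Shape \<open>k\<close>, scale 1.\<close>

definition gamma_law :: "real \<Rightarrow> real measure" where
  "gamma_law k = density lborel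
     (\<lambda>x. ennreal (if 0 < x then x powr (k - 1) * exp (- x) / Gamma k else 0))"


section \<open>Point processes and conditionally independent marks\<close>

text \<open>A random set \<open>\<Phi>\<close> of points of the plane is a homogeneous Poisson point process:
  it is locally finite, the number of points in a bounded Borel set is Poisson distributed with
  mean the intensity times the area, and counts in disjoint sets are independent.
  The Poisson probabilities are written out because sets of area 0 are included, where the mean
  is 0 and \<open>poisson_pmf\<close> is unspecified.\<close>

definition homogeneous_PPP ::
    "'w measure \<Rightarrow> real \<Rightarrow> ('w \<Rightarrow> (real^2) set) \<Rightarrow> bool" where
  "homogeneous_PPP M lam \<Phi> \<longleftrightarrow>
     (AE \<omega> in M. \<forall>B. bounded B \<longrightarrow> finite (\<Phi> \<omega> \<inter> B)) \<and>
     (\<forall>B \<in> sets borel. bounded B \<longrightarrow>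
        (\<lambda>\<omega>. card (\<Phi> \<omega> \<inter> B)) \<in> M \<rightarrow>\<^sub>M count_space UNIV \<and>
        (\<forall>n. measure M {\<omega> \<in> space M. card (\<Phi> \<omega> \<inter> B) = n} =
           (lam * measure lborel B) ^ n / fact n * exp (- (lam * measure lborel B)))) \<and>
     (\<forall>(I :: nat set) B. finite I \<longrightarrow> disjoint_family_on B I \<longrightarrow>
        (\<forall>i\<in>I. B i \<in> sets borel \<and> bounded (B i)) \<longrightarrow>
        prob_space.indep_vars M (\<lambda>_. count_space UNIV) (\<lambda>i \<omega>. card (\<Phi> \<omega> \<inter> B i)) I)"

text \<open>Given the random element \<open>W\<close>, the variables \<open>Y i\<close> are mutually independent and
  \<open>Y i\<close> has law \<open>K i (W \<omega>)\<close>: the joint law of \<open>W\<close> and any finitely many of the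
  \<open>Y i\<close> is the law of \<open>W\<close> composed with the product of the kernels.\<close>

definition cond_indep_laws ::
    "'w measure \<Rightarrow> 'b measure \<Rightarrow> ('w \<Rightarrow> 'b) \<Rightarrow> 'c measure \<Rightarrow> ('i \<Rightarrow> 'w \<Rightarrow> 'c) \<Rightarrow>
     ('i \<Rightarrow> 'b \<Rightarrow> 'c measure) \<Rightarrow> bool" where
  "cond_indep_laws M N W E Y K \<longleftrightarrow>
     W \<in> M \<rightarrow>\<^sub>M N \<and> (\<forall>i. Y i \<in> M \<rightarrow>\<^sub>M E) \<and>
     (\<forall>A \<in> sets N. \<forall>J B. finite J \<longrightarrow> (\<forall>j\<in>J. B j \<in> sets E) \<longrightarrow>
        emeasure M {\<omega> \<in> space M. W \<omega> \<in> A \<and> (\<forall>j\<in>J. Y j \<omega> \<in> B j)} =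
        (\<integral>\<^sup>+\<omega>. indicator A (W \<omega>) * (\<Prod>j\<in>J. emeasure (K j (W \<omega>)) (B j)) \<partial>M))"


section \<open>Parameters of the network\<close>

datatype link_state = LOS | NLOS

datatype lobe = Main | Side

record network_params =
  tx_power :: real                         \<comment> \<open>\<open>P\<^sub>t\<close>\<close>
  noise_power :: real                      \<comment> \<open>\<open>N\<^sub>0\<close>\<close>
  bs_intensity :: real                     \<comment> \<open>\<open>\<lambda>\<^sub>B\<close>\<close>
  eve_intensity :: real                    \<comment> \<open>\<open>\<lambda>\<^sub>E\<close>\<close>
  los_radius :: real                       \<comment> \<open>\<open>D\<close>\<close>
  los_fraction :: real                     \<comment> \<open>\<open>C\<close>\<close>
  pl_const :: "link_state \<Rightarrow> real"         \<comment> \<open>\<open>C\<^sub>L, C\<^sub>N\<close>\<close>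
  pl_exponent :: "link_state \<Rightarrow> real"      \<comment> \<open>\<open>\<alpha>\<^sub>L, \<alpha>\<^sub>N\<close>\<close>
  fading_shape :: "link_state \<Rightarrow> nat"      \<comment> \<open>\<open>N\<^sub>L, N\<^sub>N\<close>\<close>
  array_gain :: "lobe \<Rightarrow> real"             \<comment> \<open>\<open>M\<^sub>s, m\<^sub>s\<close>\<close>
  beam_width :: real                       \<comment> \<open>\<open>\<theta>\<^sub>b\<close> in degrees\<close>

definition valid_params :: "network_params \<Rightarrow> bool" where
  "valid_params P \<longleftrightarrow>
     0 < tx_power P \<and> 0 < noise_power P \<and> 0 < bs_intensity P \<and> 0 < eve_intensity P \<and>
     0 < los_radius P \<and> 0 \<le> los_fraction P \<and> los_fraction P \<le> 1 \<and>
     0 < pl_const P NLOS \<and> pl_const P NLOS < pl_const P LOS \<and>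
     0 < pl_exponent P LOS \<and> pl_exponent P LOS < pl_exponent P NLOS \<and>
     0 < fading_shape P LOS \<and> 0 < fading_shape P NLOS \<and>
     0 < array_gain P Main \<and> 0 < array_gain P Side \<and>
     0 \<le> beam_width P \<and> beam_width P \<le> 180"

definition los_prob :: "network_params \<Rightarrow> real \<Rightarrow> real" where
  "los_prob P r = (if r \<le> los_radius P then los_fraction P else 0)"

definition link_state_law :: "network_params \<Rightarrow> real \<Rightarrow> link_state measure" where
  "link_state_law P r =
     measure_pmf (map_pmf (\<lambda>b. if b then LOS else NLOS) (bernoulli_pmf (los_prob P r)))"

definition lobe_prob :: "network_params \<Rightarrow> lobe \<Rightarrow> real" where
  "lobe_prob P v = (case v of Main \<Rightarrow> beam_width P / 180 | Side \<Rightarrow> (180 - beam_width P) / 180)"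

definition array_gain_law :: "network_params \<Rightarrow> real measure" where
  "array_gain_law P = distr (measure_pmf (map_pmf (\<lambda>b. if b then Main else Side)
     (bernoulli_pmf (lobe_prob P Main)))) borel (array_gain P)"

definition path_loss :: "network_params \<Rightarrow> link_state \<Rightarrow> real \<Rightarrow> real" where
  "path_loss P j r = pl_const P j * r powr (- pl_exponent P j)"


section \<open>The random network\<close>

text \<open>Base stations and eavesdroppers are enumerated; almost surely there are infinitely many
  of each. Links and the random gains are indexed through this enumeration:
  \<open>User_Link n\<close> joins base station \<open>n\<close> to the user at the origin, \<open>Eve_Link n k\<close>
  joins base station \<open>n\<close> to eavesdropper \<open>k\<close>.\<close>

datatype link = User_Link nat | Eve_Link nat nat

text \<open>The gains \<open>h\<close> (serving base station to user), \<open>g\<close> and \<open>G\<^sub>b\<close> (serving base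
  station to eavesdropper \<open>k\<close>).\<close>

datatype gain_index = User_Fading | Eve_Fading nat | Eve_Array_Gain nat

record 'w network =
  bs :: "nat \<Rightarrow> 'w \<Rightarrow> real^2"
  eve :: "nat \<Rightarrow> 'w \<Rightarrow> real^2"
  state :: "link \<Rightarrow> 'w \<Rightarrow> link_state"
  gain :: "gain_index \<Rightarrow> 'w \<Rightarrow> real"

abbreviation config_space :: "(nat \<Rightarrow> real^2) measure" where
  "config_space \<equiv> PiM UNIV (\<lambda>_. borel)"

definition locations :: "'w network \<Rightarrow> 'w \<Rightarrow> (nat \<Rightarrow> real^2) \<times> (nat \<Rightarrow> real^2)" where
  "locations W \<omega> = ((\<lambda>n. bs W n \<omega>), (\<lambda>k. eve W k \<omega>))"

definition states :: "'w network \<Rightarrow> 'w \<Rightarrow> link \<Rightarrow> link_state" where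
  "states W \<omega> = (\<lambda>l. state W l \<omega>)"

definition link_length :: "(nat \<Rightarrow> real^2) \<times> (nat \<Rightarrow> real^2) \<Rightarrow> link \<Rightarrow> real" where
  "link_length xz l = (case l of
     User_Link n \<Rightarrow> norm (fst xz n) | Eve_Link n k \<Rightarrow> dist (fst xz n) (snd xz k))"

text \<open>The index of \<open>x\<^sup>*\<close>. The maximiser is almost surely unique; \<open>LEAST\<close> only fixes the
  value on a null set, and does so measurably.\<close>

definition serving_index ::
    "network_params \<Rightarrow> (nat \<Rightarrow> real^2) \<times> (nat \<Rightarrow> real^2) \<Rightarrow> (link \<Rightarrow> link_state) \<Rightarrow> nat" where
  "serving_index P xz s = (LEAST n. is_arg_max
     (\<lambda>m. path_loss P (s (User_Link m)) (link_length xz (User_Link m))) (\<lambda>_. True) n)"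

text \<open>Law of each gain given all locations and link states.\<close>

fun gain_law :: "network_params \<Rightarrow> gain_index \<Rightarrow>
    ((nat \<Rightarrow> real^2) \<times> (nat \<Rightarrow> real^2)) \<times> (link \<Rightarrow> link_state) \<Rightarrow> real measure" where
  "gain_law P User_Fading (xz, s) =
     gamma_law (real (fading_shape P (s (User_Link (serving_index P xz s)))))"
| "gain_law P (Eve_Fading k) (xz, s) =
     gamma_law (real (fading_shape P (s (Eve_Link (serving_index P xz s) k))))"
| "gain_law P (Eve_Array_Gain k) (xz, s) = array_gain_law P"

definition is_network :: "'w measure \<Rightarrow> network_params \<Rightarrow> 'w network \<Rightarrow> bool" where
  "is_network M P W \<longleftrightarrow>
     prob_space M \<and>
     homogeneous_PPP M (bs_intensity P) (\<lambda>\<omega>. range (\<lambda>n. bs W n \<omega>)) \<and>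
     homogeneous_PPP M (eve_intensity P) (\<lambda>\<omega>. range (\<lambda>k. eve W k \<omega>)) \<and>
     (AE \<omega> in M. inj (\<lambda>n. bs W n \<omega>)) \<and>
     (AE \<omega> in M. inj (\<lambda>k. eve W k \<omega>)) \<and>
     prob_space.indep_var M config_space (\<lambda>\<omega> n. bs W n \<omega>) config_space (\<lambda>\<omega> k. eve W k \<omega>) \<and>
     cond_indep_laws M (config_space \<Otimes>\<^sub>M config_space) (locations W)
       (count_space UNIV) (state W) (\<lambda>l xz. link_state_law P (link_length xz l)) \<and>
     cond_indep_laws M
       ((config_space \<Otimes>\<^sub>M config_space) \<Otimes>\<^sub>M PiM UNIV (\<lambda>_. count_space UNIV))
       (\<lambda>\<omega>. (locations W \<omega>, states W \<omega>)) borel (gain W) (gain_law P)"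


section \<open>Association and signal-to-noise ratios\<close>

definition serving :: "network_params \<Rightarrow> 'w network \<Rightarrow> 'w \<Rightarrow> nat" where
  "serving P W \<omega> = serving_index P (locations W \<omega>) (states W \<omega>)"

definition serving_state :: "network_params \<Rightarrow> 'w network \<Rightarrow> 'w \<Rightarrow> link_state" where
  "serving_state P W \<omega> = state W (User_Link (serving P W \<omega>)) \<omega>"

definition serving_distance :: "network_params \<Rightarrow> 'w network \<Rightarrow> 'w \<Rightarrow> real" where
  "serving_distance P W \<omega> = norm (bs W (serving P W \<omega>) \<omega>)"

definition assoc_prob :: "'w measure \<Rightarrow> network_params \<Rightarrow> 'w network \<Rightarrow> link_state \<Rightarrow> real" where
  "assoc_prob M P W j = measure M {\<omega> \<in> space M. serving_state P W \<omega> = j}"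

text \<open>The density of \<open>r\<^sub>j\<close>, as the Radon--Nikodym derivative of its (conditional) law; it is
  determined up to a Lebesgue null set.\<close>

definition serving_distance_density ::
    "'w measure \<Rightarrow> network_params \<Rightarrow> 'w network \<Rightarrow> link_state \<Rightarrow> real \<Rightarrow> real" where
  "serving_distance_density M P W j r = enn2real (RN_deriv lborel
     (distr (uniform_measure M {\<omega> \<in> space M. serving_state P W \<omega> = j}) borel
        (serving_distance P W)) r)"

definition SNR_user :: "network_params \<Rightarrow> 'w network \<Rightarrow> 'w \<Rightarrow> real" where
  "SNR_user P W \<omega> =
     tx_power P * array_gain P Main *
     path_loss P (serving_state P W \<omega>) (serving_distance P W \<omega>) *
     gain W User_Fading \<omega> / noise_power P"

definition SNR_eve :: "network_params \<Rightarrow> 'w network \<Rightarrow> nat \<Rightarrow> 'w \<Rightarrow> real" where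
  "SNR_eve P W k \<omega> =
     tx_power P * gain W (Eve_Array_Gain k) \<omega> *
     path_loss P (state W (Eve_Link (serving P W \<omega>) k) \<omega>)
       (dist (bs W (serving P W \<omega>) \<omega>) (eve W k \<omega>)) *
     gain W (Eve_Fading k) \<omega> / noise_power P"

definition connection_prob :: "'w measure \<Rightarrow> network_params \<Rightarrow> 'w network \<Rightarrow> real \<Rightarrow> real" where
  "connection_prob M P W T = measure M {\<omega> \<in> space M. SNR_user P W \<omega> \<ge> T}"

text \<open>The maximum over the infinitely many eavesdroppers is a supremum in the extended reals.\<close>

definition secrecy_prob :: "'w measure \<Rightarrow> network_params \<Rightarrow> 'w network \<Rightarrow> real \<Rightarrow> real" where
  "secrecy_prob M P W T =
     measure M {\<omega> \<in> space M. (SUP k. ereal (SNR_eve P W k \<omega>)) \<le> ereal T}"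


section \<open>The intensity \<open>\<Lambda>\<^sub>E(0,t)\<close>\<close>

definition state_weight :: "network_params \<Rightarrow> link_state \<Rightarrow> real" where
  "state_weight P j = (case j of LOS \<Rightarrow> los_fraction P | NLOS \<Rightarrow> 1 - los_fraction P)"

definition Omega_in :: "network_params \<Rightarrow> link_state \<Rightarrow> lobe \<Rightarrow> real \<Rightarrow> real" where
  "Omega_in P j v t =
     (let c = array_gain P v * pl_const P j * t; a = pl_exponent P j in
      lobe_prob P v * (c powr (2 / a) / a) *
      (\<Sum>m<fading_shape P j. lower_Gamma (real m + 2 / a) (los_radius P powr a / c) / fact m))"

definition Omega_out :: "network_params \<Rightarrow> link_state \<Rightarrow> lobe \<Rightarrow> real \<Rightarrow> real" where
  "Omega_out P j v t =
     (let c = array_gain P v * pl_const P j * t; a = pl_exponent P j in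
      lobe_prob P v * (c powr (2 / a) / a) *
      (\<Sum>m<fading_shape P j. upper_Gamma (real m + 2 / a) (los_radius P powr a / c) / fact m))"

definition Lambda_E :: "network_params \<Rightarrow> real \<Rightarrow> real" where
  "Lambda_E P t = 2 * pi * eve_intensity P *
     ((\<Sum>j\<in>{LOS, NLOS}. state_weight P j * (Omega_in P j Main t + Omega_in P j Side t)) +
      Omega_out P NLOS Main t + Omega_out P NLOS Side t)"

end

theory Submission
  imports Defs
begin

text \<open>Both formulas are obtained by disintegrating over the locations and the link states.

  Given these, the user's fading gain has an integer gamma law, so the user is connected with probability
  \<open>\<Gamma>(N\<^sub>j, x) / \<Gamma>(N\<^sub>j)\<close>; integrating against the law of the serving distance gives \<open>p\<^sub>c\<^sub>o\<^sub>n\<close>. This law has a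
  density because almost surely no base station lies in a given Lebesgue null set.

  Given the locations, the link states and gains of the eavesdroppers are independent of each other
  and of the choice of \<open>x\<^sup>*\<close>, so that all eavesdroppers fail with probability
  \<open>\<Prod>\<^sub>z (1 - p(\<parallel>x\<^sup>* - z\<parallel>))\<close>. Since \<open>x\<^sup>*\<close> is independent of the Poisson process of
  eavesdroppers, the probability generating functional turns the mean of this product into
  \<open>exp (- \<lambda>\<^sub>E \<integral> p(\<parallel>z\<parallel>) dz)\<close>, whatever \<open>x\<^sup>*\<close> is. For an integer shape, \<open>p\<close> is a finite sum of terms
  \<open>y\<^sup>m exp (- y) / m!\<close> in \<open>y = \<parallel>z\<parallel>\<^sup>\<alpha> / c\<close>, and the image of Lebesgue measure under
  \<open>z \<mapsto> y\<close> has a density proportional to a power of \<open>y\<close>; this yields the incomplete gamma functions.\<close>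

text \<open>The obstacle is that the serving base station is chosen through the link states, while
  the laws of the gains refer to the states of the links of whichever base station was chosen.
  Conditioning therefore has two stages: the gains given locations and states, then the states given
  the locations. In the second stage the choice reads only the user links, which are coordinates of
  the product measure disjoint from the eavesdropper links. With the user links in the outer
  integral, the serving index is constant in the inner one, and the links from that one base station
  are distinct, hence independent coordinates.

  The hypotheses speak of finitely many marks and of counts in bounded sets. Both are extended
  before use: the conditional laws to the infinite product kernel, the Poisson property to
  integrable functions with values in [0,1]. An infinite product is always represented as the
  infimum over K of the products over the first K points. These decrease because all factors lie in
  [0,1], so monotone convergence moves the infimum through the integrals.

  Translation invariance of area is what removes the position of the serving base station from the
  result.\<close>

section \<open>Planar Lebesgue measure in powers of the radius\<close>

text \<open>The preimage of \<open>{..x}\<close> is the disc of radius (c x)^(1/a), of area \<pi> (c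
  x)^(2/a), and the density is the derivative of that area. Half-lines generate the Borel sets, so
  comparing these values is enough. The factor \<open>c powr (2 / a) / a\<close> is the prefactor of
  \<open>Omega_in\<close> and \<open>Omega_out\<close>.\<close>

lemma distr_norm_powr:
  fixes a c :: real
  assumes a: "0 < a" and c: "0 < c"
  shows "distr lborel borel (\<lambda>z::real^2. norm z powr a / c) =
    density lborel (\<lambda>x. ennreal (if 0 \<le> x then 2 * pi * (c powr (2 / a) / a) * x powr (2 / a - 1) else 0))"
    (is "?D = ?R")
proof (rule measure_eqI_generator_eq[where \<Omega> = UNIV and E = "range atMost" and A = "\<lambda>i. {..real i}"])
  let ?k = "2 * pi * (c powr (2 / a) / a)"
  have [measurable]: "(\<lambda>z::real^2. norm z powr a / c) \<in> borel_measurable borel"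
    by measurable
  have k: "0 \<le> ?k"
    using a by simp
  have L: "emeasure ?D {..x} = ennreal (if x < 0 then 0 else pi * (c * x) powr (2 / a))" for x
  proof (cases "x < 0")
    case True
    moreover have "0 \<le> norm z powr a / c" for z :: "real^2"
      using c by simp
    ultimately have "(\<lambda>z::real^2. norm z powr a / c) -` {..x} = {}"
      by (fastforce simp: not_le dest: order_trans)
    then show ?thesis
      using True by (simp add: emeasure_distr)
  next
    case False
    define \<rho> where "\<rho> = (c * x) powr (1 / a)"
    have "norm z powr a / c \<le> x \<longleftrightarrow> norm z \<le> \<rho>" for z :: "real^2"
    proof -
      have "norm z powr a / c \<le> x \<longleftrightarrow> norm z powr a \<le> c * x"
        using c by (simp add: field_simps)
      also have "c * x = \<rho> powr a"
        using False a c by (simp add: \<rho>_def powr_powr)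
      also have "norm z powr a \<le> \<rho> powr a \<longleftrightarrow> norm z \<le> \<rho>"
        using a powr_mono2[of a "norm z" \<rho>] powr_less_mono2[of a \<rho> "norm z"]
        by (auto simp: \<rho>_def not_le simp flip: not_le)
      finally show ?thesis .
    qed
    then have "(\<lambda>z::real^2. norm z powr a / c) -` {..x} = cball 0 \<rho>"
      by (auto simp: dist_norm)
    moreover have "\<rho> \<ge> 0"
      by (simp add: \<rho>_def)
    moreover have "\<rho>\<^sup>2 = (c * x) powr (2 / a)"
      by (simp add: \<rho>_def power2_eq_square flip: powr_add)
    ultimately show ?thesis
      using False by (simp add: emeasure_distr emeasure_cball eval_unit_ball_vol)
  qed
  have R: "emeasure ?R {..x} = ennreal (if x < 0 then 0 else pi * (c * x) powr (2 / a))" for x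
  proof (cases "x < 0")
    case True
    then show ?thesis
      by (auto simp: emeasure_density indicator_def intro!: nn_integral_0_iff_AE[THEN iffD2])
  next
    case False
    \<comment> \<open>The exponent exceeds -1, so the integral converges at 0 even when a > 2 makes
      the integrand unbounded there.\<close>
    have "((\<lambda>y. y powr (2 / a - 1)) has_integral (x powr (2 / a - 1 + 1) / (2 / a - 1 + 1))) {0..x}"
      using False a by (intro has_integral_powr_from_0) auto
    from has_integral_mult_right[OF this, of ?k]
    have "((\<lambda>y. ?k * y powr (2 / a - 1)) has_integral ?k * (x powr (2 / a) / (2 / a))) {0..x}"
      by simp
    then have "(\<integral>\<^sup>+y. ennreal (?k * y powr (2 / a - 1)) * indicator {0..x} y \<partial>lborel) =
        ennreal (?k * (x powr (2 / a) / (2 / a)))"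
      by (rule nn_integral_has_integral_lebesgue'[rotated]) (use a in simp)
    also have "?k * (x powr (2 / a) / (2 / a)) = pi * (c * x) powr (2 / a)"
      using a c False by (simp add: powr_mult)
    finally show ?thesis
      using False
      by (subst emeasure_density) (auto simp: indicator_def intro!: nn_integral_cong elim!: trans[rotated])
  qed
  show "X \<in> range atMost \<Longrightarrow> emeasure ?D X = emeasure ?R X" for X
    using L R by auto
  show "emeasure ?D {..real i} \<noteq> \<infinity>" for i
    by (simp add: L)
  show "sets ?D = sigma_sets UNIV (range atMost)" "sets ?R = sigma_sets UNIV (range atMost)"
    by (simp_all add: borel_eq_atMost)
  show "(\<Union>i. {..real i}) = UNIV"
    by (auto intro: real_arch_simple)
qed (auto simp: Int_stable_def)

section \<open>The probability generating functional of a Poisson process\<close>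

text \<open>The generating function of the Poisson law, by the exponential series. Mean 0 and b = 0
  are included, with 0^0 = 1.\<close>

lemma (in prob_space) nn_integral_power_Poisson:
  fixes N :: "'a \<Rightarrow> nat" and b \<mu> :: real
  assumes N[measurable]: "N \<in> M \<rightarrow>\<^sub>M count_space UNIV"
    and P: "\<And>n. prob {\<omega>\<in>space M. N \<omega> = n} = \<mu> ^ n / fact n * exp (- \<mu>)"
    and b: "0 \<le> b" and \<mu>: "0 \<le> \<mu>"
  shows "(\<integral>\<^sup>+\<omega>. ennreal (b ^ N \<omega>) \<partial>M) = ennreal (exp (- ((1 - b) * \<mu>)))"
proof -
  have "(\<integral>\<^sup>+\<omega>. ennreal (b ^ N \<omega>) \<partial>M) =
      (\<integral>\<^sup>+\<omega>. (\<Sum>n. ennreal (b ^ n) * indicator {\<omega>\<in>space M. N \<omega> = n} \<omega>) \<partial>M)"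
  proof (intro nn_integral_cong)
    fix \<omega> assume "\<omega> \<in> space M"
    then have "(\<Sum>n. ennreal (b ^ n) * indicator {\<omega>\<in>space M. N \<omega> = n} \<omega>) =
        (\<Sum>n\<in>{N \<omega>}. ennreal (b ^ n) * indicator {\<omega>\<in>space M. N \<omega> = n} \<omega>)"
      by (intro suminf_finite) auto
    then show "ennreal (b ^ N \<omega>) = (\<Sum>n. ennreal (b ^ n) * indicator {\<omega>\<in>space M. N \<omega> = n} \<omega>)"
      using \<open>\<omega> \<in> space M\<close> by simp
  qed
  also have "\<dots> = (\<Sum>n. ennreal (b ^ n) * emeasure M {\<omega>\<in>space M. N \<omega> = n})"
    by (subst nn_integral_suminf) (auto simp: nn_integral_cmult_indicator)
  also have "\<dots> = (\<Sum>n. ennreal ((b * \<mu>) ^ n /\<^sub>R fact n * exp (- \<mu>)))"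
    using b \<mu> by (simp add: emeasure_eq_measure P power_mult_distrib divide_inverse mult_ac flip: ennreal_mult)
  also have "\<dots> = ennreal (exp (b * \<mu>) * exp (- \<mu>))"
    using b \<mu> by (intro suminf_ennreal_eq sums_mult2 exp_converges) auto
  also have "exp (b * \<mu>) * exp (- \<mu>) = exp (- ((1 - b) * \<mu>))"
    by (simp add: algebra_simps flip: exp_add)
  finally show ?thesis .
qed

text \<open>Only finitely many indices k have \<open>z k\<close> in some \<open>B i\<close>. Beyond
  them the partial products are constant, and before that they are larger, as no factor exceeds 1.
  Injectivity of \<open>z\<close> lets the number of points in \<open>B i\<close> replace the number
  of indices.\<close>

lemma INF_prod_indicators:
  fixes z :: "nat \<Rightarrow> 'a" and b :: "'i \<Rightarrow> real"
  assumes z: "inj z" and I: "finite I"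
    and fin: "\<And>i. i \<in> I \<Longrightarrow> finite (range z \<inter> B i)"
    and b: "\<And>i. i \<in> I \<Longrightarrow> 0 \<le> b i \<and> b i \<le> 1"
  shows "(INF K. ennreal (\<Prod>k<K. \<Prod>i\<in>I. if z k \<in> B i then b i else 1)) =
    ennreal (\<Prod>i\<in>I. b i ^ card (range z \<inter> B i))"
    (is "(INF K. ennreal (?P K)) = ennreal ?T")
proof -
  have P: "?P K = (\<Prod>i\<in>I. b i ^ card {k. k < K \<and> z k \<in> B i})" for K
  proof -
    have "?P K = (\<Prod>i\<in>I. \<Prod>k<K. if z k \<in> B i then b i else 1)"
      by (rule prod.swap)
    also have "\<dots> = (\<Prod>i\<in>I. b i ^ card {k. k < K \<and> z k \<in> B i})"
      by (intro prod.cong refl) (simp add: prod.If_cases Int_def)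
    finally show ?thesis .
  qed
  have S: "finite (z -` B i)" "card (z -` B i) = card (range z \<inter> B i)" if "i \<in> I" for i
  proof -
    have "z -` B i = z -` (range z \<inter> B i)"
      by auto
    then show "finite (z -` B i)"
      using fin[OF that] z by (metis finite_vimageI)
    have "range z \<inter> B i = z ` (z -` B i)"
      by auto
    then show "card (z -` B i) = card (range z \<inter> B i)"
      using z by (metis card_image inj_on_subset subset_UNIV)
  qed
  then have "finite (\<Union>i\<in>I. z -` B i)"
    using I by auto
  then obtain K0 where K0: "\<And>k i. i \<in> I \<Longrightarrow> z k \<in> B i \<Longrightarrow> k < K0"
    by (auto simp: finite_nat_set_iff_bounded)
  have T: "?P K = ?T" if "K0 \<le> K" for K
    unfolding P
  proof (intro prod.cong refl)
    fix i assume i: "i \<in> I"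
    have "{k. k < K \<and> z k \<in> B i} = z -` B i"
      using K0[OF i] that by fastforce
    then show "b i ^ card {k. k < K \<and> z k \<in> B i} = b i ^ card (range z \<inter> B i)"
      using S[OF i] by simp
  qed
  have "?T \<le> ?P K" for K
    unfolding P
  proof (intro prod_mono conjI power_decreasing)
    fix i assume i: "i \<in> I"
    show "card {k. k < K \<and> z k \<in> B i} \<le> card (range z \<inter> B i)"
      unfolding S(2)[OF i, symmetric] using S(1)[OF i] by (intro card_mono) auto
  qed (use b in auto)
  then show ?thesis
    using T[of K0] by (intro antisym INF_greatest INF_lower2[of K0]) (auto intro: ennreal_leI)
qed

text \<open>The level sets of a step function are disjoint, so the counts in them are independent
  and Poisson. The product over all points is then a product of powers
  \<open>(1 - e i) ^ N i\<close>, whose mean factors into Poisson generating functions.\<close>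

lemma (in prob_space) homogeneous_PPP_pgfl_simple:
  fixes p :: "real^2 \<Rightarrow> real" and Z :: "nat \<Rightarrow> 'a \<Rightarrow> real^2"
  assumes PPP: "homogeneous_PPP M lam (\<lambda>\<omega>. range (\<lambda>k. Z k \<omega>))"
    and inj: "AE \<omega> in M. inj (\<lambda>k. Z k \<omega>)"
    and lam: "0 \<le> lam"
    and p[measurable]: "p \<in> borel_measurable borel" and p01: "\<And>x. 0 \<le> p x" "\<And>x. p x \<le> 1"
    and fin: "finite (range p)" and bdd: "bounded {x. p x \<noteq> 0}"
  shows "(\<integral>\<^sup>+\<omega>. (INF K. ennreal (\<Prod>k<K. 1 - p (Z k \<omega>))) \<partial>M) = ennreal (exp (- (lam * (\<integral>x. p x \<partial>lborel))))"
proof -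
  \<comment> \<open>The value 0 is left out: its level set is unbounded, so
    \<open>homogeneous_PPP\<close> gives no law for its count, and its points contribute only
    factors 1. Natural numbers index the levels because the independence clause of
    \<open>homogeneous_PPP\<close> does.\<close>
  obtain e :: "nat \<Rightarrow> real" and m where e: "bij_betw e {..<m} (range p - {0})"
    using fin by (metis ex_bij_betw_nat_finite finite_Diff lessThan_atLeast0)
  define B where "B i = {x. p x = e i}" for i
  have ei: "e i \<noteq> 0" "0 \<le> e i" "e i \<le> 1" if "i < m" for i
  proof -
    have "e i \<in> range p - {0}"
      using bij_betwE[OF e] that by simp
    then obtain x where "e i = p x" "p x \<noteq> 0"
      by auto
    then show "e i \<noteq> 0" "0 \<le> e i" "e i \<le> 1"
      using p01[of x] by auto
  qed
  have B[measurable]: "B i \<in> sets borel" for i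
    unfolding B_def by measurable
  have Bb: "bounded (B i)" if "i < m" for i
    using bdd ei(1)[OF that] by (rule_tac bounded_subset) (auto simp: B_def)
  \<comment> \<open>A point lies in exactly one of the level sets, or in none if p vanishes there,
    so at most one factor survives.\<close>
  have delta: "(\<Prod>i<m. if x \<in> B i then f i else 1) = (if p x = 0 then 1 else f (the_inv_into {..<m} e (p x)))"
    for f :: "nat \<Rightarrow> real" and x
  proof (cases "p x = 0")
    case True
    then show ?thesis
      using ei by (auto simp: B_def intro!: prod.neutral)
  next
    case False
    then have px: "p x \<in> e ` {..<m}"
      using e by (auto simp: bij_betw_def)
    let ?i = "the_inv_into {..<m} e (p x)"
    have i: "?i < m" "e ?i = p x"
      using px e by (auto simp: bij_betw_def f_the_inv_into_f the_inv_into_into[of e _ "p x" "{..<m}"]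
        dest: the_inv_into_into[of e _ "p x" "{..<m}"])
    have "(\<Prod>i<m. if x \<in> B i then f i else 1) = (\<Prod>i<m. if i = ?i then f i else 1)"
      using i e by (intro prod.cong) (auto simp: B_def bij_betw_def inj_on_def)
    then show ?thesis
      using False i by simp
  qed
  have p_eq: "1 - p x = (\<Prod>i<m. if x \<in> B i then 1 - e i else 1)" for x
  proof (cases "p x = 0")
    case False
    then have "p x \<in> e ` {..<m}"
      using e by (auto simp: bij_betw_def)
    then show ?thesis
      using e False by (simp add: delta bij_betw_def f_the_inv_into_f)
  qed (simp add: delta)
  let ?N = "\<lambda>i \<omega>. card (range (\<lambda>k. Z k \<omega>) \<inter> B i)"
  have N[measurable]: "?N i \<in> M \<rightarrow>\<^sub>M count_space UNIV" if "i < m" for i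
    using PPP B Bb[OF that] unfolding homogeneous_PPP_def by blast
  have NP: "prob {\<omega> \<in> space M. ?N i \<omega> = n} = (lam * measure lborel (B i)) ^ n / fact n * exp (- (lam * measure lborel (B i)))"
    if "i < m" for i n
    using PPP B Bb[OF that] unfolding homogeneous_PPP_def by blast
  have disj: "disjoint_family_on B {..<m}"
    using e by (auto simp: disjoint_family_on_def B_def bij_betw_def inj_on_def)
  then have ind: "indep_vars (\<lambda>_. count_space UNIV) ?N {..<m}"
    using PPP B Bb unfolding homogeneous_PPP_def by blast
  have "AE \<omega> in M. (INF K. ennreal (\<Prod>k<K. 1 - p (Z k \<omega>))) = (\<Prod>i<m. ennreal ((1 - e i) ^ ?N i \<omega>))"
  proof -
    have "AE \<omega> in M. \<forall>B. bounded B \<longrightarrow> finite (range (\<lambda>k. Z k \<omega>) \<inter> B)"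
      using PPP unfolding homogeneous_PPP_def by blast
    with inj show ?thesis
    proof eventually_elim
      case (elim \<omega>)
      have "(INF K. ennreal (\<Prod>k<K. 1 - p (Z k \<omega>))) = ennreal (\<Prod>i<m. (1 - e i) ^ ?N i \<omega>)"
        unfolding p_eq
        by (rule INF_prod_indicators[of "\<lambda>k. Z k \<omega>" "{..<m}" B "\<lambda>i. 1 - e i"]) (use elim Bb ei in auto)
      also have "\<dots> = (\<Prod>i<m. ennreal ((1 - e i) ^ ?N i \<omega>))"
        using ei by (intro prod_ennreal[symmetric]) auto
      finally show ?case .
    qed
  qed
  then have "(\<integral>\<^sup>+\<omega>. (INF K. ennreal (\<Prod>k<K. 1 - p (Z k \<omega>))) \<partial>M) =
      (\<integral>\<^sup>+\<omega>. (\<Prod>i<m. ennreal ((1 - e i) ^ ?N i \<omega>)) \<partial>M)"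
    by (rule nn_integral_cong_AE)
  also have "\<dots> = (\<Prod>i<m. \<integral>\<^sup>+\<omega>. ennreal ((1 - e i) ^ ?N i \<omega>) \<partial>M)"
    by (intro indep_vars_nn_integral indep_vars_compose2[OF ind]) auto
  also have "\<dots> = (\<Prod>i<m. ennreal (exp (- (e i * (lam * measure lborel (B i))))))"
    using lam ei NP by (intro prod.cong refl) (subst nn_integral_power_Poisson, auto)
  also have "\<dots> = ennreal (exp (- (lam * (\<Sum>i<m. e i * measure lborel (B i)))))"
    by (simp add: prod_ennreal exp_sum[symmetric] sum_negf sum_distrib_left mult_ac)
  also have "(\<Sum>i<m. e i * measure lborel (B i)) = (\<integral>x. (\<Sum>i<m. e i * indicator (B i) x) \<partial>lborel)"
    using Bb by (subst Bochner_Integration.integral_sum)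
      (auto intro!: integrable_mult_right integrable_real_indicator emeasure_bounded_finite)
  also have "\<dots> = (\<integral>x. p x \<partial>lborel)"
  proof (intro Bochner_Integration.integral_cong refl)
    fix x
    show "(\<Sum>i<m. e i * indicator (B i) x) = p x"
    proof (cases "p x = 0")
      case True
      then show ?thesis
        using ei by (auto simp: B_def intro!: sum.neutral)
    next
      case False
      then obtain j where j: "j < m" "p x = e j"
        using e by (auto simp: bij_betw_def)
      then have "(\<Sum>i<m. e i * indicator (B i) x) = (\<Sum>i<m. if i = j then e i else 0)"
        using e by (intro sum.cong) (auto simp: B_def bij_betw_def inj_on_def indicator_def)
      then show ?thesis
        using j by simp
    qed
  qed
  finally show ?thesis .
qed

text \<open>Step functions of bounded support increase to p. Along them the products decrease, so
  the left side converges monotonically, and the right side converges by domination by p.\<close>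

lemma (in prob_space) homogeneous_PPP_pgfl:
  fixes p :: "real^2 \<Rightarrow> real" and Z :: "nat \<Rightarrow> 'a \<Rightarrow> real^2"
  assumes PPP: "homogeneous_PPP M lam (\<lambda>\<omega>. range (\<lambda>k. Z k \<omega>))"
    and inj: "AE \<omega> in M. inj (\<lambda>k. Z k \<omega>)"
    and Z[measurable]: "\<And>k. Z k \<in> M \<rightarrow>\<^sub>M borel"
    and lam: "0 \<le> lam"
    and p: "integrable lborel p" and p01: "\<And>x. 0 \<le> p x" "\<And>x. p x \<le> 1"
  shows "(\<integral>\<^sup>+\<omega>. (INF K. ennreal (\<Prod>k<K. 1 - p (Z k \<omega>))) \<partial>M) = ennreal (exp (- (lam * (\<integral>x. p x \<partial>lborel))))"
proof -
  have pm[measurable]: "p \<in> borel_measurable borel"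
    using borel_measurable_integrable[OF p] by simp
  obtain u :: "nat \<Rightarrow> real^2 \<Rightarrow> ennreal" where u: "\<And>i. simple_function borel (u i)" "incseq u"
      "\<And>i x. u i x < top" "\<And>x. (SUP i. u i x) = ennreal (p x)"
    by (rule borel_measurable_implies_simple_function_sequence'[of "\<lambda>x. ennreal (p x)" borel]) auto
  \<comment> \<open>Cutting off at radius i provides the bounded support; for each x the cut-off
    eventually has no effect.\<close>
  define q where "q i x = enn2real (u i x) * indicator (ball 0 (real i)) x" for i x
  have um[measurable]: "u i \<in> borel_measurable borel" for i
    using u(1) by (rule borel_measurable_simple_function)
  have [measurable]: "ball (0 :: real^2) r \<in> sets borel" for r
    by simp
  have qm[measurable]: "q i \<in> borel_measurable borel" for i
    unfolding q_def by measurable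
  have inc: "u i x \<le> u j x" if "i \<le> j" for i j x
    using u(2) that by (auto simp: incseq_def le_fun_def)
  have up: "enn2real (u i x) \<le> p x" for i x
    using p01(1) SUP_upper[of i UNIV "\<lambda>i. u i x"] u(4)[of x] by (intro enn2real_leI) auto
  have q01: "0 \<le> q i x" "q i x \<le> p x" "q i x \<le> 1" for i x
    using up[of i x] p01[of x] by (auto simp: q_def indicator_def)
  have q_inc: "q i x \<le> q j x" if "i \<le> j" for i j x
    using inc[OF that, of x] that u(3)[of j x]
    by (auto simp: q_def indicator_def intro!: enn2real_mono)
  have q_lim: "(\<lambda>i. q i x) \<longlonglongrightarrow> p x" for x
  proof -
    have "(\<lambda>i. u i x) \<longlonglongrightarrow> ennreal (p x)"
      unfolding u(4)[symmetric] using inc by (intro LIMSEQ_SUP) (auto simp: incseq_def)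
    then have "(\<lambda>i. enn2real (u i x)) \<longlonglongrightarrow> p x"
      using p01(1) u(3) by (intro tendsto_enn2real) auto
    moreover have "\<forall>\<^sub>F i in sequentially. enn2real (u i x) = q i x"
    proof -
      obtain n where "norm x < real n"
        using reals_Archimedean2 by blast
      then show ?thesis
        by (intro eventually_sequentiallyI[of n]) (auto simp: q_def)
    qed
    ultimately show ?thesis
      by (rule Lim_transform_eventually)
  qed
  let ?F = "\<lambda>i \<omega>. INF K. ennreal (\<Prod>k<K. 1 - q i (Z k \<omega>))"
  have F: "integral\<^sup>N M (?F i) = ennreal (exp (- (lam * (\<integral>x. q i x \<partial>lborel))))" for i
  proof (rule homogeneous_PPP_pgfl_simple[OF PPP inj lam])
    have "range (q i) \<subseteq> (\<lambda>y. enn2real y) ` (u i ` space borel) \<union> {0}"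
      by (auto simp: q_def indicator_def)
    then show "finite (range (q i))"
      using u(1)[of i] by (rule_tac finite_subset) (auto simp: simple_function_def)
    show "bounded {x. q i x \<noteq> 0}"
      by (rule bounded_subset[of "ball 0 (real i)"]) (auto simp: q_def indicator_def)
  qed (use q01 in auto)
  have "(\<lambda>i. \<integral>x. q i x \<partial>lborel) \<longlonglongrightarrow> (\<integral>x. p x \<partial>lborel)"
    by (rule integral_dominated_convergence[where w = p]) (use p q_lim q01 in auto)
  then have lim1: "(\<lambda>i. integral\<^sup>N M (?F i)) \<longlonglongrightarrow> ennreal (exp (- (lam * (\<integral>x. p x \<partial>lborel))))"
    unfolding F by (intro tendsto_intros)
  have dec: "decseq ?F"
    using q_inc q01 by (intro antimonoI le_funI INF_mono' ennreal_leI prod_mono) auto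
  then have "(\<lambda>i. integral\<^sup>N M (?F i)) \<longlonglongrightarrow> (INF i. integral\<^sup>N M (?F i))"
    by (intro LIMSEQ_INF) (auto intro!: antimonoI nn_integral_mono dest: antimonoD le_funD)
  also have "(INF i. integral\<^sup>N M (?F i)) = (\<integral>\<^sup>+\<omega>. (INF i. ?F i \<omega>) \<partial>M)"
    using dec by (intro nn_integral_monotone_convergence_INF_decseq[symmetric, where i=0])
      (simp_all add: F)
  also have "\<dots> = (\<integral>\<^sup>+\<omega>. (INF K. ennreal (\<Prod>k<K. 1 - p (Z k \<omega>))) \<partial>M)"
  proof (intro nn_integral_cong)
    fix \<omega>
    \<comment> \<open>The infima over i and K commute, so the limit in i only has to pass through
      products of finitely many factors.\<close>
    have "(INF i. ennreal (\<Prod>k<K. 1 - q i (Z k \<omega>))) = ennreal (\<Prod>k<K. 1 - p (Z k \<omega>))" for K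
    proof (rule LIMSEQ_unique)
      show "(\<lambda>i. ennreal (\<Prod>k<K. 1 - q i (Z k \<omega>))) \<longlonglongrightarrow> (INF i. ennreal (\<Prod>k<K. 1 - q i (Z k \<omega>)))"
        using q_inc q01 by (intro LIMSEQ_INF) (auto simp: decseq_def intro!: ennreal_leI prod_mono)
      show "(\<lambda>i. ennreal (\<Prod>k<K. 1 - q i (Z k \<omega>))) \<longlonglongrightarrow> ennreal (\<Prod>k<K. 1 - p (Z k \<omega>))"
        by (intro tendsto_intros q_lim)
    qed
    then show "(INF i. ?F i \<omega>) = (INF K. ennreal (\<Prod>k<K. 1 - p (Z k \<omega>)))"
      by (subst INF_commute) simp
  qed
  finally show ?thesis
    using lim1 LIMSEQ_unique by blast
qed

section \<open>Conditional independence and product kernels\<close>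

text \<open>Cylinder sets generate the product and are stable under intersection, and on them the
  mass is a finite product of measurable functions of \<open>w\<close>.\<close>

lemma measurable_PiM_kernel:
  fixes K :: "'a \<Rightarrow> 'i \<Rightarrow> 'b measure"
  assumes K: "\<And>i. (\<lambda>w. K w i) \<in> N \<rightarrow>\<^sub>M prob_algebra E"
  shows "(\<lambda>w. PiM UNIV (K w)) \<in> N \<rightarrow>\<^sub>M prob_algebra (PiM UNIV (\<lambda>_. E))"
proof (rule measurable_prob_algebra_generated[OF sets_PiM Int_stable_prod_algebra prod_algebra_sets_into_space])
  fix w assume w: "w \<in> space N"
  have Kw: "prob_space (K w i)" "sets (K w i) = sets E" for i
    using measurable_space[OF K w] by (auto simp: space_prob_algebra)
  then show "prob_space (PiM UNIV (K w))"
    by (intro prob_space_PiM)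
  show "sets (PiM UNIV (K w)) = sets (PiM UNIV (\<lambda>_. E))"
    using Kw by (intro sets_PiM_cong) auto
next
  fix A assume "A \<in> prod_algebra (UNIV :: 'i set) (\<lambda>_. E)"
  then obtain J X where A: "A = prod_emb (UNIV :: 'i set) (\<lambda>_. E) J (Pi\<^sub>E J X)"
    and J: "finite J" "\<And>j. j \<in> J \<Longrightarrow> X j \<in> sets E"
    unfolding prod_algebra_def by (auto split: if_splits)
  have "emeasure (PiM UNIV (K w)) A = (\<Prod>j\<in>J. emeasure (K w j) (X j))" if w: "w \<in> space N" for w
  proof -
    have Kw: "prob_space (K w i)" "sets (K w i) = sets E" for i
      using measurable_space[OF K w] by (auto simp: space_prob_algebra)
    have "A = prod_emb UNIV (K w) J (Pi\<^sub>E J X)"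
      using sets_eq_imp_space_eq[OF Kw(2)] by (simp add: A prod_emb_def)
    then show ?thesis
      using J Kw by (simp add: emeasure_PiM_emb)
  qed
  moreover have "(\<lambda>w. \<Prod>j\<in>J. emeasure (K w j) (X j)) \<in> borel_measurable N"
    using J K by (intro borel_measurable_prod_ennreal)
      (auto intro!: measurable_emeasure_kernel[of _ _ E] measurable_prob_algebraD)
  ultimately show "(\<lambda>w. emeasure (PiM UNIV (K w)) A) \<in> borel_measurable N"
    by (simp cong: measurable_cong)
qed

text \<open>\<open>cond_indep_laws\<close> fixes the joint law only on sets given by W and finitely
  many marks. Two uniqueness arguments extend it: for a fixed event on W, cylinder sets determine
  the law of the whole family of marks; then rectangles determine the joint law of W and the
  family.\<close>

lemma cond_indep_laws_nn_integral:
  fixes Y :: "'i \<Rightarrow> 'w \<Rightarrow> 'c"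
  assumes M: "prob_space M"
    and ci: "cond_indep_laws M N W E Y K"
    and K: "\<And>i. K i \<in> N \<rightarrow>\<^sub>M prob_algebra E"
    and F: "(\<lambda>(w, y). F w y) \<in> borel_measurable (N \<Otimes>\<^sub>M PiM UNIV (\<lambda>_. E))"
  shows "(\<integral>\<^sup>+\<omega>. F (W \<omega>) (\<lambda>i. Y i \<omega>) \<partial>M) =
    (\<integral>\<^sup>+\<omega>. (\<integral>\<^sup>+y. F (W \<omega>) y \<partial>PiM UNIV (\<lambda>i. K i (W \<omega>))) \<partial>M)"
proof -
  let ?P = "PiM (UNIV :: 'i set) (\<lambda>_. E)"
  let ?Q = "\<lambda>w. PiM UNIV (\<lambda>i. K i w)"
  interpret prob_space M by fact
  have W[measurable]: "W \<in> M \<rightarrow>\<^sub>M N" and Y[measurable]: "\<And>i. Y i \<in> M \<rightarrow>\<^sub>M E"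
    and eq: "\<And>A J B. A \<in> sets N \<Longrightarrow> finite J \<Longrightarrow> (\<And>j. j \<in> J \<Longrightarrow> B j \<in> sets E) \<Longrightarrow>
        emeasure M {\<omega> \<in> space M. W \<omega> \<in> A \<and> (\<forall>j\<in>J. Y j \<omega> \<in> B j)} =
        (\<integral>\<^sup>+\<omega>. indicator A (W \<omega>) * (\<Prod>j\<in>J. emeasure (K j (W \<omega>)) (B j)) \<partial>M)"
    using ci unfolding cond_indep_laws_def by auto
  have YP[measurable]: "(\<lambda>\<omega> i. Y i \<omega>) \<in> M \<rightarrow>\<^sub>M ?P"
    using Y[THEN measurable_space] by (intro measurable_PiM_single') auto
  have Q[measurable]: "?Q \<in> N \<rightarrow>\<^sub>M prob_algebra ?P"
    using K by (intro measurable_PiM_kernel)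
  have Qs[measurable]: "?Q \<in> N \<rightarrow>\<^sub>M subprob_algebra ?P"
    using Q by (rule measurable_prob_algebraD)
  have QW: "(\<lambda>\<omega>. ?Q (W \<omega>)) \<in> M \<rightarrow>\<^sub>M subprob_algebra ?P"
    by measurable
  have sQ: "sets (?Q (W \<omega>)) = sets ?P" if "\<omega> \<in> space M" for \<omega>
    using measurable_space[OF QW that] by (simp add: space_subprob_algebra)
  \<comment> \<open>The kernel carries \<open>W \<omega>\<close> along as first coordinate, so that
    mixing it over M produces a law of pairs, to be compared with the law of W and the
    marks.\<close>
  let ?k = "\<lambda>\<omega>. distr (?Q (W \<omega>)) (N \<Otimes>\<^sub>M ?P) (Pair (W \<omega>))"
  have k: "?k \<in> M \<rightarrow>\<^sub>M subprob_algebra (N \<Otimes>\<^sub>M ?P)"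
    by (rule measurable_distr2[where M="?P"]) (use QW in measurable)
  have rect: "emeasure M {\<omega>\<in>space M. W \<omega> \<in> A \<and> (\<lambda>i. Y i \<omega>) \<in> B} =
      (\<integral>\<^sup>+\<omega>. indicator A (W \<omega>) * emeasure (?Q (W \<omega>)) B \<partial>M)"
    if A[measurable]: "A \<in> sets N" and B: "B \<in> sets ?P" for A B
  proof -
    \<comment> \<open>Restricting M to the event that W lies in A turns the claim into an equality
      of two finite measures on the mark space, which cylinder sets decide.\<close>
    let ?M = "density M (\<lambda>\<omega>. indicator A (W \<omega>))"
    have k': "(\<lambda>\<omega>. ?Q (W \<omega>)) \<in> ?M \<rightarrow>\<^sub>M subprob_algebra ?P"
      using QW by simp
    have ne: "space ?M \<noteq> {}"
      by (simp add: not_empty)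
    have D: "emeasure (distr ?M ?P (\<lambda>\<omega> i. Y i \<omega>)) B =
        emeasure M {\<omega>\<in>space M. W \<omega> \<in> A \<and> (\<lambda>i. Y i \<omega>) \<in> B}"
      if [measurable]: "B \<in> sets ?P" for B
    proof -
      have "emeasure (distr ?M ?P (\<lambda>\<omega> i. Y i \<omega>)) B =
          (\<integral>\<^sup>+\<omega>. indicator {\<omega>\<in>space M. W \<omega> \<in> A \<and> (\<lambda>i. Y i \<omega>) \<in> B} \<omega> \<partial>M)"
        by (simp add: emeasure_distr emeasure_density del: nn_integral_indicator)
           (auto intro!: nn_integral_cong simp: indicator_def)
      also have "\<dots> = emeasure M {\<omega>\<in>space M. W \<omega> \<in> A \<and> (\<lambda>i. Y i \<omega>) \<in> B}"
        by (intro nn_integral_indicator) measurable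
      finally show ?thesis .
    qed
    have "distr ?M ?P (\<lambda>\<omega> i. Y i \<omega>) = ?M \<bind> (\<lambda>\<omega>. ?Q (W \<omega>))"
    proof (rule measure_eqI_PiM_infinite)
      show "sets (?M \<bind> (\<lambda>\<omega>. ?Q (W \<omega>))) = sets ?P"
        using sQ ne by (intro sets_bind) auto
      show "finite_measure (distr ?M ?P (\<lambda>\<omega> i. Y i \<omega>))"
      proof (rule finite_measure.finite_measure_distr)
        have "emeasure ?M (space ?M) \<le> (\<integral>\<^sup>+\<omega>. 1 \<partial>M)"
          by (auto simp: emeasure_density indicator_def intro!: nn_integral_mono simp del: nn_integral_const)
        then show "finite_measure ?M"
          by (intro finite_measureI) (auto simp: emeasure_space_1 top_unique)
      qed measurable
    next
      fix X and J :: "'i set" assume J: "finite J" and X: "\<And>i. i \<in> J \<Longrightarrow> X i \<in> sets E"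
      let ?X = "prod_emb (UNIV :: 'i set) (\<lambda>_. E) J (Pi\<^sub>E J X)"
      have [measurable]: "?X \<in> sets ?P"
        using J X by (intro sets_PiM_I) auto
      have "emeasure (distr ?M ?P (\<lambda>\<omega> i. Y i \<omega>)) ?X =
          emeasure M {\<omega>\<in>space M. W \<omega> \<in> A \<and> (\<lambda>i. Y i \<omega>) \<in> ?X}"
        by (rule D) simp
      also have "\<dots> = emeasure M {\<omega>\<in>space M. W \<omega> \<in> A \<and> (\<forall>j\<in>J. Y j \<omega> \<in> X j)}"
        using Y[THEN measurable_space]
        by (auto intro!: arg_cong[where f = "emeasure M"] simp: prod_emb_def PiE_iff)
      also have "\<dots> = (\<integral>\<^sup>+\<omega>. indicator A (W \<omega>) * (\<Prod>j\<in>J. emeasure (K j (W \<omega>)) (X j)) \<partial>M)"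
        using J X by (intro eq) auto
      also have "\<dots> = (\<integral>\<^sup>+\<omega>. indicator A (W \<omega>) * emeasure (?Q (W \<omega>)) ?X \<partial>M)"
      proof (intro nn_integral_cong arg_cong2[where f="(*)"] refl)
        fix \<omega> assume "\<omega> \<in> space M"
        then have w: "W \<omega> \<in> space N"
          using W by (rule measurable_space[rotated])
        have Kw: "prob_space (K i (W \<omega>))" "sets (K i (W \<omega>)) = sets E" for i
          using measurable_space[OF K w] by (auto simp: space_prob_algebra)
        have "?X = prod_emb UNIV (\<lambda>i. K i (W \<omega>)) J (Pi\<^sub>E J X)"
          using sets_eq_imp_space_eq[OF Kw(2)] by (simp add: prod_emb_def)
        then show "(\<Prod>j\<in>J. emeasure (K j (W \<omega>)) (X j)) = emeasure (?Q (W \<omega>)) ?X"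
          using J Kw X by (simp add: emeasure_PiM_emb)
      qed
      also have "\<dots> = emeasure (?M \<bind> (\<lambda>\<omega>. ?Q (W \<omega>))) ?X"
        using QW by (subst emeasure_bind[OF ne k'])
          (auto simp: nn_integral_density intro!: nn_integral_density[symmetric] measurable_emeasure_kernel)
      finally show "emeasure (distr ?M ?P (\<lambda>\<omega> i. Y i \<omega>)) ?X = emeasure (?M \<bind> (\<lambda>\<omega>. ?Q (W \<omega>))) ?X" .
    qed simp
    then have "emeasure (distr ?M ?P (\<lambda>\<omega> i. Y i \<omega>)) B = emeasure (?M \<bind> (\<lambda>\<omega>. ?Q (W \<omega>))) B"
      by simp
    moreover note D[OF B]
    moreover have "emeasure (?M \<bind> (\<lambda>\<omega>. ?Q (W \<omega>))) B =
        (\<integral>\<^sup>+\<omega>. indicator A (W \<omega>) * emeasure (?Q (W \<omega>)) B \<partial>M)"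
      using QW B by (subst emeasure_bind[OF ne k'])
          (auto simp: nn_integral_density intro!: nn_integral_density measurable_emeasure_kernel)
    ultimately show ?thesis
      by simp
  qed
  have "distr M (N \<Otimes>\<^sub>M ?P) (\<lambda>\<omega>. (W \<omega>, \<lambda>i. Y i \<omega>)) = M \<bind> ?k"
  proof (rule measure_eqI_generator_eq[where A = "\<lambda>_. space N \<times> space ?P" and \<Omega> = "space N \<times> space ?P"
        and E = "{a \<times> b | a b. a \<in> sets N \<and> b \<in> sets ?P}"])
    show "Int_stable {a \<times> b | a b. a \<in> sets N \<and> b \<in> sets ?P}"
      by (rule Int_stable_pair_measure_generator)
    show "{a \<times> b | a b. a \<in> sets N \<and> b \<in> sets ?P} \<subseteq> Pow (space N \<times> space ?P)"
      by (rule pair_measure_closed)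
    have "sets (M \<bind> ?k) = sets (N \<Otimes>\<^sub>M ?P)"
      using k by (simp add: not_empty)
    then show "sets (M \<bind> ?k) = sigma_sets (space N \<times> space ?P) {a \<times> b | a b. a \<in> sets N \<and> b \<in> sets ?P}"
      by (simp add: sets_pair_measure)
    fix X assume "X \<in> {a \<times> b | a b. a \<in> sets N \<and> b \<in> sets ?P}"
    then obtain A B where X: "X = A \<times> B" and [measurable]: "A \<in> sets N" "B \<in> sets ?P"
      by auto
    have "emeasure (M \<bind> ?k) X = (\<integral>\<^sup>+\<omega>. emeasure (?k \<omega>) X \<partial>M)"
      using k by (intro emeasure_bind) (auto simp: not_empty X)
    also have "\<dots> = (\<integral>\<^sup>+\<omega>. indicator A (W \<omega>) * emeasure (?Q (W \<omega>)) B \<partial>M)"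
    proof (intro nn_integral_cong)
      fix \<omega> assume o: "\<omega> \<in> space M"
      then have [measurable]: "W \<omega> \<in> space N"
        using W by (rule measurable_space[rotated])
      have "emeasure (?k \<omega>) X = emeasure (?Q (W \<omega>)) (Pair (W \<omega>) -` X \<inter> space (?Q (W \<omega>)))"
        using sQ[OF o] by (intro emeasure_distr) (auto simp: X cong: measurable_cong_sets)
      also have "Pair (W \<omega>) -` X \<inter> space (?Q (W \<omega>)) = (if W \<omega> \<in> A then B else {})"
        using sets.sets_into_space[of B ?P] sets_eq_imp_space_eq[OF sQ[OF o]] by (auto simp: X)
      finally show "emeasure (?k \<omega>) X = indicator A (W \<omega>) * emeasure (?Q (W \<omega>)) B"
        by simp
    qed
    finally show "emeasure (distr M (N \<Otimes>\<^sub>M ?P) (\<lambda>\<omega>. (W \<omega>, \<lambda>i. Y i \<omega>))) X = emeasure (M \<bind> ?k) X"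
      by (simp add: X emeasure_distr flip: rect) (auto intro!: arg_cong[where f = "emeasure M"])
  next
    show "emeasure (distr M (N \<Otimes>\<^sub>M ?P) (\<lambda>\<omega>. (W \<omega>, \<lambda>i. Y i \<omega>))) (space N \<times> space ?P) \<noteq> \<infinity>"
      by (subst emeasure_distr) (auto intro!: pair_measureI)
  qed (auto simp: sets_pair_measure)
  then have "(\<integral>\<^sup>+x. (case x of (w, y) \<Rightarrow> F w y) \<partial>distr M (N \<Otimes>\<^sub>M ?P) (\<lambda>\<omega>. (W \<omega>, \<lambda>i. Y i \<omega>))) =
      (\<integral>\<^sup>+x. (case x of (w, y) \<Rightarrow> F w y) \<partial>(M \<bind> ?k))"
    by simp
  also have "\<dots> = (\<integral>\<^sup>+\<omega>. (\<integral>\<^sup>+x. (case x of (w, y) \<Rightarrow> F w y) \<partial>?k \<omega>) \<partial>M)"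
    by (rule nn_integral_bind[OF F k])
  also have "\<dots> = (\<integral>\<^sup>+\<omega>. (\<integral>\<^sup>+y. F (W \<omega>) y \<partial>?Q (W \<omega>)) \<partial>M)"
  proof (intro nn_integral_cong)
    fix \<omega> assume o: "\<omega> \<in> space M"
    then have [measurable]: "W \<omega> \<in> space N"
      using W by (rule measurable_space[rotated])
    show "(\<integral>\<^sup>+x. (case x of (w, y) \<Rightarrow> F w y) \<partial>?k \<omega>) = (\<integral>\<^sup>+y. F (W \<omega>) y \<partial>?Q (W \<omega>))"
      using sQ[OF o] F by (subst nn_integral_distr) (auto cong: measurable_cong_sets)
  qed
  finally show ?thesis
    using F by (simp add: nn_integral_distr)
qed

section \<open>Integration over independent coordinates of a product measure\<close>

lemma indep_vars_PiM_coordinates: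
  assumes "\<And>i. prob_space (K i)"
  shows "prob_space.indep_vars (PiM UNIV K) K (\<lambda>i \<omega>. \<omega> i) UNIV"
proof -
  interpret prob_space "PiM UNIV K"
    using assms by (rule prob_space_PiM)
  show ?thesis
    using assms by (subst indep_vars_iff_distr_eq_PiM) (simp_all add: distr_PiM_component distr_id2 restrict_def)
qed

lemma nn_integral_PiM_prod:
  assumes K: "\<And>i. prob_space (K i)" and J: "finite J" "inj_on a J"
    and f: "\<And>k. k \<in> J \<Longrightarrow> f k \<in> borel_measurable (K (a k))"
  shows "(\<integral>\<^sup>+y. (\<Prod>k\<in>J. f k (y (a k))) \<partial>PiM UNIV K) = (\<Prod>k\<in>J. \<integral>\<^sup>+t. f k t \<partial>K (a k))"
proof -
  interpret prob_space "PiM UNIV K"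
    using K by (rule prob_space_PiM)
  \<comment> \<open>Independence is indexed by coordinates, the product by J. The inverse of a
    translates, and its injectivity ensures that no coordinate serves two factors.\<close>
  define h where "h i = f (the_inv_into J a i)" for i
  have h: "h (a k) = f k" if "k \<in> J" for k
    using J that by (simp add: h_def the_inv_into_f_f)
  have ind: "indep_vars (\<lambda>_. borel) (\<lambda>i y. h i (y i)) (a ` J)"
    by (rule indep_vars_compose2[OF indep_vars_subset[OF indep_vars_PiM_coordinates[OF K] subset_UNIV]])
       (use f h in auto)
  have "(\<integral>\<^sup>+y. (\<Prod>k\<in>J. f k (y (a k))) \<partial>PiM UNIV K) = (\<integral>\<^sup>+y. (\<Prod>i\<in>a ` J. h i (y i)) \<partial>PiM UNIV K)"
    using J by (simp add: prod.reindex h)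
  also have "\<dots> = (\<Prod>i\<in>a ` J. \<integral>\<^sup>+y. h i (y i) \<partial>PiM UNIV K)"
    using J ind by (intro indep_vars_nn_integral) auto
  also have "\<dots> = (\<Prod>k\<in>J. \<integral>\<^sup>+y. f k (y (a k)) \<partial>PiM UNIV K)"
    using J by (simp add: prod.reindex h)
  also have "\<dots> = (\<Prod>k\<in>J. \<integral>\<^sup>+t. f k t \<partial>distr (PiM UNIV K) (K (a k)) (\<lambda>y. y (a k)))"
    using f by (intro prod.cong refl nn_integral_distr[symmetric]) auto
  finally show ?thesis
    using K by (simp add: distr_PiM_component)
qed

text \<open>Restrictions to disjoint sets of coordinates are independent, so the two subfamilies
  have a product law and Fubini applies. F need not factor, which matters because the serving index
  depends on all user links at once.\<close>

lemma nn_integral_PiM_split: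
  fixes K :: "'i \<Rightarrow> 'x measure" and f :: "'a \<Rightarrow> 'i" and g :: "'b \<Rightarrow> 'i"
  assumes K: "\<And>i. prob_space (K i)" and fg: "inj f" "inj g" "range f \<inter> range g = {}"
    and F: "(\<lambda>(u, v). F u v) \<in> borel_measurable (PiM UNIV (\<lambda>a. K (f a)) \<Otimes>\<^sub>M PiM UNIV (\<lambda>b. K (g b)))"
  shows "(\<integral>\<^sup>+y. F (\<lambda>a. y (f a)) (\<lambda>b. y (g b)) \<partial>PiM UNIV K) =
    (\<integral>\<^sup>+u. (\<integral>\<^sup>+v. F u v \<partial>PiM UNIV (\<lambda>b. K (g b))) \<partial>PiM UNIV (\<lambda>a. K (f a)))"
proof -
  let ?f = "PiM UNIV (\<lambda>a. K (f a))" and ?g = "PiM UNIV (\<lambda>b. K (g b))"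
  interpret prob_space "PiM UNIV K"
    using K by (rule prob_space_PiM)
  interpret g: prob_space ?g
    using K by (rule prob_space_PiM)
  have mf: "(\<lambda>h a. h (f a)) \<in> PiM (range f) K \<rightarrow>\<^sub>M ?f" and mg: "(\<lambda>h b. h (g b)) \<in> PiM (range g) K \<rightarrow>\<^sub>M ?g"
    by (auto intro!: measurable_PiM_single' simp: space_PiM PiE_iff)
  have mf': "(\<lambda>h a. h (f a)) \<in> PiM UNIV K \<rightarrow>\<^sub>M ?f" and mg': "(\<lambda>h b. h (g b)) \<in> PiM UNIV K \<rightarrow>\<^sub>M ?g"
    by (auto intro!: measurable_PiM_single' simp: space_PiM PiE_iff)
  let ?A = "PiM (range f) K" and ?B = "PiM (range g) K"
  interpret B: prob_space ?B
    using K by (rule prob_space_PiM)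
  have ind: "indep_var ?A (\<lambda>y. restrict y (range f)) ?B (\<lambda>y. restrict y (range g))"
    using indep_var_restrict[OF indep_vars_PiM_coordinates[OF K], of "range f" "range g"] fg by simp
  have "?f = distr ?A ?f (\<lambda>h a. h (f a))"
    using distr_PiM_reindex[of "range f" K f UNIV] K fg by (simp add: restrict_def)
  moreover have g: "?g = distr ?B ?g (\<lambda>h b. h (g b))"
    using distr_PiM_reindex[of "range g" K g UNIV] K fg by (simp add: restrict_def)
  ultimately have "?f \<Otimes>\<^sub>M ?g = distr ?A ?f (\<lambda>h a. h (f a)) \<Otimes>\<^sub>M distr ?B ?g (\<lambda>h b. h (g b))"
    by simp
  also have "\<dots> = distr (?A \<Otimes>\<^sub>M ?B) (?f \<Otimes>\<^sub>M ?g) (\<lambda>(h, h'). (\<lambda>a. h (f a), \<lambda>b. h' (g b)))"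
    using mf mg g by (intro pair_measure_distr) (simp_all add: g.sigma_finite_measure_axioms flip: g)
  also have "?A \<Otimes>\<^sub>M ?B = distr (PiM UNIV K) ?A (\<lambda>y. restrict y (range f)) \<Otimes>\<^sub>M
      distr (PiM UNIV K) ?B (\<lambda>y. restrict y (range g))"
    using distr_PiM_reindex[of UNIV K "\<lambda>i. i" "range f"] distr_PiM_reindex[of UNIV K "\<lambda>i. i" "range g"] K
    by simp
  also have "\<dots> = distr (PiM UNIV K) (?A \<Otimes>\<^sub>M ?B) (\<lambda>y. (restrict y (range f), restrict y (range g)))"
    using ind by (simp add: indep_var_distribution_eq)
  also have "distr \<dots> (?f \<Otimes>\<^sub>M ?g) (\<lambda>(h, h'). (\<lambda>a. h (f a), \<lambda>b. h' (g b))) =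
      distr (PiM UNIV K) (?f \<Otimes>\<^sub>M ?g) (\<lambda>y. (\<lambda>a. y (f a), \<lambda>b. y (g b)))"
    using mf mg by (subst distr_distr) (auto simp: comp_def)
  finally have D: "distr (PiM UNIV K) (?f \<Otimes>\<^sub>M ?g) (\<lambda>y. (\<lambda>a. y (f a), \<lambda>b. y (g b))) = ?f \<Otimes>\<^sub>M ?g" ..
  have "(\<integral>\<^sup>+y. F (\<lambda>a. y (f a)) (\<lambda>b. y (g b)) \<partial>PiM UNIV K) =
      (\<integral>\<^sup>+x. (case x of (u, v) \<Rightarrow> F u v) \<partial>distr (PiM UNIV K) (?f \<Otimes>\<^sub>M ?g) (\<lambda>y. (\<lambda>a. y (f a), \<lambda>b. y (g b))))"
    using F mf' mg' by (subst nn_integral_distr) auto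
  also have "\<dots> = (\<integral>\<^sup>+u. (\<integral>\<^sup>+v. F u v \<partial>?g) \<partial>?f)"
    unfolding D using g.nn_integral_fst[OF F] by simp
  finally show ?thesis .
qed

section \<open>Gains and link states\<close>

lemma sets_gamma_law [simp, measurable_cong]: "sets (gamma_law k) = sets borel"
  by (simp add: gamma_law_def)

text \<open>Erlang index k means shape k + 1. The densities can differ only at 0, where for k = 0
  one is 0 and the other 1; a single point has measure 0.\<close>

lemma gamma_law_eq_erlang: "gamma_law (real (Suc k)) = density lborel (erlang_density k 1)"
  unfolding gamma_law_def
proof (rule density_cong)
  show "AE x in lborel. ennreal (if 0 < x then x powr (real (Suc k) - 1) * exp (- x) / Gamma (real (Suc k)) else 0) =
      ennreal (erlang_density k 1 x)"
    using AE_lborel_singleton[of "0::real"]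
  proof eventually_elim
    case (elim x)
    have "Gamma (real (Suc k)) = fact k"
      using Gamma_fact[of k, where 'a = real] by (simp add: add_ac)
    then show ?case
      using elim by (auto simp: erlang_density_def powr_realpow)
  qed
qed auto

lemma prob_space_gamma_law: "0 < n \<Longrightarrow> prob_space (gamma_law (real n))"
  using prob_space_erlang_density[of 1 "n - 1"] gamma_law_eq_erlang[of "n - 1"] by simp

lemma emeasure_gamma_law_atMost:
  assumes "0 < n" "0 \<le> x"
  shows "emeasure (gamma_law (real n)) {..x} = ennreal (1 - (\<Sum>m<n. x ^ m * exp (- x) / fact m))"
proof -
  obtain k where k: "n = Suc k"
    using assms(1) gr0_implies_Suc by blast
  show ?thesis
    using assms(2) unfolding k gamma_law_eq_erlang
    by (subst emeasure_erlang_density) (simp_all add: erlang_CDF_def lessThan_Suc_atMost)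
qed

lemma emeasure_gamma_law_atLeast:
  assumes n: "0 < n" and x: "0 \<le> x"
  shows "emeasure (gamma_law (real n)) {x..} = ennreal (upper_Gamma (real n) x / Gamma (real n))"
proof -
  interpret prob_space "gamma_law (real n)"
    using n by (rule prob_space_gamma_law)
  let ?f = "\<lambda>t. indicator {x..} t * (t powr (real n - 1) * exp (- t)) / Gamma (real n)"
  have G: "0 < Gamma (real n)"
    using n by (intro Gamma_real_pos) simp
  have "emeasure (gamma_law (real n)) {x..} = (\<integral>\<^sup>+t. ennreal (?f t) \<partial>lborel)"
    unfolding gamma_law_def
  proof (subst emeasure_density, simp, simp, rule nn_integral_cong_AE)
    show "AE t in lborel. ennreal (if 0 < t then t powr (real n - 1) * exp (- t) / Gamma (real n) else 0) *
        indicator {x..} t = ennreal (?f t)"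
      using AE_lborel_singleton[of "0::real"] by eventually_elim (use x in \<open>auto simp: indicator_def\<close>)
  qed
  moreover have "(\<integral>t. ?f t \<partial>lborel) = enn2real (\<integral>\<^sup>+t. ennreal (?f t) \<partial>lborel)"
    using G by (intro integral_eq_nn_integral) auto
  moreover have "(\<integral>t. ?f t \<partial>lborel) = upper_Gamma (real n) x / Gamma (real n)"
    by (simp add: upper_Gamma_def set_lebesgue_integral_def)
  \<comment> \<open>\<open>enn2real\<close> can be undone because the integral is a probability,
    hence finite.\<close>
  ultimately show ?thesis
    by (metis emeasure_finite ennreal_enn2real top.not_eq_extremum)
qed

section \<open>Measurability of the serving index and of the conditional laws\<close>

lemma countable_link_state: "countable (UNIV :: link_state set)"
proof -
  have "(UNIV :: link_state set) = {LOS, NLOS}"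
    using link_state.exhaust by auto
  then show ?thesis
    by (metis countable_empty countable_insert)
qed

lemma measurable_apply_link_state:
  fixes g :: "'a \<Rightarrow> link_state"
  assumes "g \<in> M \<rightarrow>\<^sub>M count_space UNIV" "\<And>j. f j \<in> M \<rightarrow>\<^sub>M N"
  shows "(\<lambda>x. f (g x) x) \<in> M \<rightarrow>\<^sub>M N"
  by (rule measurable_compose_countable'[OF assms(2,1) countable_link_state])

lemma measurable_path_loss [measurable (raw)]:
  assumes "g \<in> M \<rightarrow>\<^sub>M count_space UNIV" and [measurable]: "r \<in> borel_measurable M"
  shows "(\<lambda>x. path_loss P (g x) (r x)) \<in> borel_measurable M"
  by (rule measurable_apply_link_state[OF assms(1)]) (simp add: path_loss_def)

lemma measurable_link_state_law [measurable (raw)]: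
  assumes [measurable]: "r \<in> borel_measurable M"
  shows "(\<lambda>x. link_state_law P (r x)) \<in> M \<rightarrow>\<^sub>M prob_algebra (count_space UNIV)"
proof -
  let ?L = "\<lambda>p. measure_pmf (map_pmf (\<lambda>b. if b then LOS else NLOS) (bernoulli_pmf p))"
  have "link_state_law P = (\<lambda>r. if r \<le> los_radius P then ?L (los_fraction P) else ?L 0)"
    by (auto simp: link_state_law_def los_prob_def)
  moreover have "?L p \<in> space (prob_algebra (count_space UNIV))" for p
    by (auto simp: space_prob_algebra intro: measure_pmf.prob_space_axioms)
  ultimately show ?thesis
    by simp
qed

text \<open>\<open>serving_index\<close> cut down to the data it reads, the base stations and the
  user links. In this form the eavesdroppers and their links visibly have no influence on the
  choice.\<close>

definition user_serving_index :: "network_params \<Rightarrow> (nat \<Rightarrow> real^2) \<Rightarrow> (nat \<Rightarrow> link_state) \<Rightarrow> nat" where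
  "user_serving_index P x u = (LEAST n. is_arg_max (\<lambda>m. path_loss P (u m) (norm (x m))) (\<lambda>_. True) n)"

lemma serving_index_eq: "serving_index P xz s = user_serving_index P (fst xz) (\<lambda>n. s (User_Link n))"
  by (simp add: serving_index_def user_serving_index_def link_length_def)

lemma measurable_user_serving_index [measurable (raw)]:
  assumes [measurable]: "\<And>n. (\<lambda>w. x w n) \<in> borel_measurable M" "\<And>n. (\<lambda>w. u w n) \<in> M \<rightarrow>\<^sub>M count_space UNIV"
  shows "(\<lambda>w. user_serving_index P (x w) (u w)) \<in> M \<rightarrow>\<^sub>M count_space UNIV"
  unfolding user_serving_index_def is_arg_max_def by measurable

lemma measurable_link_length [measurable]:
  "(\<lambda>xz. link_length xz l) \<in> borel_measurable (config_space \<Otimes>\<^sub>M config_space)"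
  by (cases l) (simp_all add: link_length_def)

abbreviation state_space :: "(link \<Rightarrow> link_state) measure" where
  "state_space \<equiv> PiM UNIV (\<lambda>_. count_space UNIV)"

lemma measurable_serving_index [measurable]:
  "(\<lambda>(xz, s). serving_index P xz s) \<in> (config_space \<Otimes>\<^sub>M config_space) \<Otimes>\<^sub>M state_space \<rightarrow>\<^sub>M count_space UNIV"
  unfolding serving_index_eq by measurable

lemma prob_space_array_gain_law: "prob_space (array_gain_law P)"
  unfolding array_gain_law_def by (rule measure_pmf.prob_space_distr) simp

lemma sets_array_gain_law [simp, measurable_cong]: "sets (array_gain_law P) = sets borel"
  by (simp add: array_gain_law_def)

lemma measurable_gain_law:
  assumes "valid_params P"
  shows "gain_law P i \<in> (config_space \<Otimes>\<^sub>M config_space) \<Otimes>\<^sub>M state_space \<rightarrow>\<^sub>M prob_algebra borel"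
proof -
  have N: "0 < fading_shape P j" for j
    using assms by (cases j) (auto simp: valid_params_def)
  have g: "(\<lambda>j. gamma_law (real (fading_shape P j))) \<in> count_space UNIV \<rightarrow>\<^sub>M prob_algebra borel"
    using N by (auto simp: space_prob_algebra prob_space_gamma_law)
  have a: "array_gain_law P \<in> space (prob_algebra borel)"
    by (auto simp: space_prob_algebra prob_space_array_gain_law)
  let ?i = "\<lambda>w. serving_index P (fst w) (snd w)"
  have i: "?i \<in> (config_space \<Otimes>\<^sub>M config_space) \<Otimes>\<^sub>M state_space \<rightarrow>\<^sub>M count_space UNIV"
    using measurable_serving_index[of P] by (simp add: case_prod_unfold)
  have s: "(\<lambda>w. snd w (l (?i w))) \<in> (config_space \<Otimes>\<^sub>M config_space) \<Otimes>\<^sub>M state_space \<rightarrow>\<^sub>M count_space UNIV"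
    for l :: "nat \<Rightarrow> link"
    by (rule measurable_compose_countable[OF _ i]) measurable
  show ?thesis
  proof (cases i)
    case User_Fading
    then have "gain_law P i = (\<lambda>w. gamma_law (real (fading_shape P (snd w (User_Link (?i w))))))"
      by auto
    then show ?thesis
      using measurable_compose[OF s g] by simp
  next
    case (Eve_Fading k)
    then have "gain_law P i = (\<lambda>w. gamma_law (real (fading_shape P (snd w (Eve_Link (?i w) k)))))"
      by auto
    then show ?thesis
      using measurable_compose[OF s[of "\<lambda>n. Eve_Link n k"] g] by simp
  next
    case (Eve_Array_Gain k)
    then have "gain_law P i = (\<lambda>w. array_gain_law P)"
      by auto
    then show ?thesis
      using a by simp
  qed
qed

section \<open>The intensity of insecure eavesdroppers\<close>

text \<open>The probability that a gamma variable of integer shape n and scale 1 exceeds y,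
  equivalently that a Poisson variable of mean y is less than n.\<close>

definition erlang_tail :: "nat \<Rightarrow> real \<Rightarrow> real" where
  "erlang_tail n y = (\<Sum>m<n. y ^ m * exp (- y) / fact m)"

lemma borel_measurable_erlang_tail [measurable]: "erlang_tail n \<in> borel_measurable borel"
  unfolding erlang_tail_def[abs_def] by measurable

lemma erlang_tail_bounds:
  assumes "0 < n" "0 \<le> y"
  shows "0 \<le> erlang_tail n y" "erlang_tail n y \<le> 1"
proof -
  show "0 \<le> erlang_tail n y"
    using assms by (auto simp: erlang_tail_def intro!: sum_nonneg)
  obtain k where k: "n = Suc k"
    using assms(1) gr0_implies_Suc by blast
  show "erlang_tail n y \<le> 1"
    using erlang_CDF_nonneg[of 1 k y] assms(2)
    by (simp add: erlang_tail_def erlang_CDF_def k lessThan_Suc_atMost)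
qed

section \<open>Incomplete gamma functions as integrals over the plane\<close>

lemma set_integrable_Gamma_integrand:
  assumes s: "0 < s" and S[measurable]: "S \<in> sets borel" and "S \<subseteq> {0..}"
  shows "set_integrable lborel S (\<lambda>t::real. t powr (s - 1) * exp (- t))"
proof (rule set_integrable_subset[OF _ _ \<open>S \<subseteq> {0..}\<close>])
  have "(\<integral>\<^sup>+t. ennreal (t powr (s - 1) / exp t) * indicator {0..} t \<partial>lborel) = ennreal (Gamma s)"
    by (rule nn_integral_has_integral_lebesgue'[OF _ Gamma_integral_real[OF s]]) simp
  also have "(\<integral>\<^sup>+t. ennreal (t powr (s - 1) / exp t) * indicator {0..} t \<partial>lborel) =
      (\<integral>\<^sup>+t. ennreal (norm (indicator {0..} t *\<^sub>R (t powr (s - 1) * exp (- t)))) \<partial>lborel)"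
    by (intro nn_integral_cong) (auto simp: indicator_def exp_minus field_simps)
  finally show "set_integrable lborel {0..} (\<lambda>t::real. t powr (s - 1) * exp (- t))"
    unfolding set_integrable_def by (intro integrableI_bounded) auto
qed simp

text \<open>Substitution of y for \<open>norm z powr a / c\<close> by
  \<open>distr_norm_powr\<close>. The integrand contributes y^m and the density y^(2/a - 1);
  together they form the gamma integrand of index m + 2/a.\<close>

lemma has_bochner_integral_norm_powr:
  fixes a c :: real
  assumes a: "0 < a" and c: "0 < c" and S[measurable]: "S \<in> sets borel" and S0: "S \<subseteq> {0..}"
  shows "has_bochner_integral lborel
    (\<lambda>z::real^2. indicator S (norm z powr a / c) * ((norm z powr a / c) ^ m * exp (- (norm z powr a / c))))
    (2 * pi * (c powr (2 / a) / a) * (LBINT t:S. t powr (real m + 2 / a - 1) * exp (- t)))"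
proof -
  let ?k = "2 * pi * (c powr (2 / a) / a)"
  let ?d = "\<lambda>x. if 0 \<le> x then ?k * x powr (2 / a - 1) else 0"
  let ?g = "\<lambda>y::real. indicator S y * (y ^ m * exp (- y)) :: real"
  let ?h = "\<lambda>t. indicator S t *\<^sub>R (t powr (real m + 2 / a - 1) * exp (- t))"
  have [measurable]: "(\<lambda>z::real^2. norm z powr a / c) \<in> borel_measurable borel"
    by measurable
  have AE: "AE x in lborel. ?d x *\<^sub>R ?g x = ?k * ?h x"
    using AE_lborel_singleton[of "0::real"]
  proof eventually_elim
    case (elim x)
    show ?case
    proof (cases "x \<in> S")
      case True
      then have "x > 0"
        using S0 elim by (auto simp: order.order_iff_strict)
      moreover from this have "x powr (real m + 2 / a - 1) = x powr (2 / a - 1) * x ^ m"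
        by (simp add: powr_realpow[symmetric] powr_add[symmetric] add_ac add_diff_eq)
      ultimately show ?thesis
        by simp
    qed simp
  qed
  have "integrable lborel ?h"
    using set_integrable_Gamma_integrand[OF _ S S0, of "real m + 2 / a"] a
    by (simp add: set_integrable_def add_pos_nonneg add_nonneg_pos)
  then have "has_bochner_integral lborel (\<lambda>x. ?k * ?h x) (?k * (\<integral>x. ?h x \<partial>lborel))"
    by (intro has_bochner_integral_mult_right has_bochner_integral_integrable)
  then have "has_bochner_integral lborel (\<lambda>x. ?d x *\<^sub>R ?g x) (?k * (\<integral>x. ?h x \<partial>lborel))"
    by (rule has_bochner_integral_cong_AE[THEN iffD1, rotated 3]) (use AE in auto)
  then have "has_bochner_integral (density lborel (\<lambda>x. ennreal (?d x))) ?g (?k * (\<integral>x. ?h x \<partial>lborel))"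
    by (rule has_bochner_integral_density[rotated 3]) (use a in auto)
  then have "has_bochner_integral (distr lborel borel (\<lambda>z::real^2. norm z powr a / c)) ?g (?k * (\<integral>x. ?h x \<partial>lborel))"
    by (simp only: distr_norm_powr[OF a c])
  then have "has_bochner_integral lborel (\<lambda>z::real^2. ?g (norm z powr a / c)) (?k * (\<integral>x. ?h x \<partial>lborel))"
    by (simp add: has_bochner_integral_iff integrable_distr_eq integral_distr)
  then show ?thesis
    by (simp add: set_lebesgue_integral_def)
qed

lemma has_bochner_integral_erlang_tail_norm:
  fixes a c :: real
  assumes a: "0 < a" and c: "0 < c" and S[measurable]: "S \<in> sets borel" and S0: "S \<subseteq> {0..}"
  shows "has_bochner_integral lborel
    (\<lambda>z::real^2. w * (indicator S (norm z powr a / c) * erlang_tail n (norm z powr a / c)))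
    (2 * pi * (w * (c powr (2 / a) / a) *
      (\<Sum>m<n. (LBINT t:S. t powr (real m + 2 / a - 1) * exp (- t)) / fact m)))"
proof -
  have "has_bochner_integral lborel
      (\<lambda>z::real^2. \<Sum>m<n. indicator S (norm z powr a / c) * ((norm z powr a / c) ^ m * exp (- (norm z powr a / c))) * (w / fact m))
      (\<Sum>m<n. 2 * pi * (c powr (2 / a) / a) * (LBINT t:S. t powr (real m + 2 / a - 1) * exp (- t)) * (w / fact m))"
    by (intro has_bochner_integral_sum has_bochner_integral_mult_left has_bochner_integral_norm_powr assms)
  then show ?thesis
    by (simp add: erlang_tail_def sum_distrib_left mult_ac)
qed

lemma valid_paramsD:
  assumes "valid_params P"
  shows "0 < tx_power P" "0 < noise_power P" "0 < eve_intensity P" "0 < los_radius P"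
    "0 \<le> los_fraction P" "los_fraction P \<le> 1" "0 < pl_const P j" "0 < pl_exponent P j"
    "0 < fading_shape P j" "0 < array_gain P v" "0 \<le> lobe_prob P v"
    "lobe_prob P Main + lobe_prob P Side = 1"
  using assms by (cases j; cases v; auto simp: valid_params_def lobe_prob_def field_simps)+

text \<open>In the variable y the disc of radius D becomes y \<le> D^a / c, which explains the
  second argument of the incomplete gamma functions: the disc gives the lower one, its complement
  the upper one.\<close>

lemma has_bochner_integral_Omega:
  assumes P: "valid_params P" and t: "0 < t"
  shows "has_bochner_integral lborel (\<lambda>z::real^2. lobe_prob P v * (indicator {..los_radius P} (norm z) *
      erlang_tail (fading_shape P j) (norm z powr pl_exponent P j / (array_gain P v * pl_const P j * t))))
      (2 * pi * Omega_in P j v t)" (is ?in)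
    and "has_bochner_integral lborel (\<lambda>z::real^2. lobe_prob P v * (indicator {los_radius P<..} (norm z) *
      erlang_tail (fading_shape P j) (norm z powr pl_exponent P j / (array_gain P v * pl_const P j * t))))
      (2 * pi * Omega_out P j v t)" (is ?out)
proof -
  define c a D where "c = array_gain P v * pl_const P j * t" and "a = pl_exponent P j" and "D = los_radius P"
  have pos: "0 < a" "0 < c" "0 < D"
    using valid_paramsD[OF P] t by (auto simp: c_def a_def D_def)
  have mono: "norm z powr a / c \<le> D powr a / c \<longleftrightarrow> norm z \<le> D" for z :: "real^2"
    using pos powr_mono2[of a "norm z" D] powr_less_mono2[of a D "norm z"]
    by (auto simp: divide_le_cancel not_le simp flip: not_le)
  have "indicator {0..D powr a / c} (norm z powr a / c) = (indicator {..D} (norm z) :: real)" for z :: "real^2"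
    using mono[of z] pos by (auto simp: indicator_def)
  then show ?in
    using has_bochner_integral_erlang_tail_norm[OF pos(1,2), of "{0..D powr a / c}" "lobe_prob P v" "fading_shape P j"]
    by (simp add: Omega_in_def lower_Gamma_def Let_def c_def a_def D_def)
  have "indicator {D powr a / c<..} (norm z powr a / c) = (indicator {D<..} (norm z) :: real)" for z :: "real^2"
    using mono[of z] by (auto simp: indicator_def)
  \<comment> \<open>Distance D itself belongs to the disc, so its complement yields an open
    half-line, whereas \<open>upper_Gamma\<close> uses a closed one. The endpoint has measure
    0.\<close>
  moreover have "upper_Gamma s x = (LBINT u:{x<..}. u powr (s - 1) * exp (- u))" for s x
    unfolding upper_Gamma_def set_lebesgue_integral_def
    by (intro integral_cong_AE) (use AE_lborel_singleton[of x] in \<open>auto simp: indicator_def elim!: eventually_mono\<close>)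
  moreover have "{D powr a / c<..} \<subseteq> {0..}"
    using divide_nonneg_pos[OF powr_ge_zero pos(2), of D a] by auto
  ultimately show ?out
    using has_bochner_integral_erlang_tail_norm[OF pos(1,2), of "{D powr a / c<..}" "lobe_prob P v" "fading_shape P j"]
    by (simp add: Omega_out_def Let_def c_def a_def D_def)
qed

text \<open>Probability that an eavesdropper at distance \<open>r\<close>, whose link is in state \<open>j\<close>, does
  not exceed the threshold; \<open>eve_secure\<close> averages over the link state.\<close>

definition eve_secure_given :: "network_params \<Rightarrow> real \<Rightarrow> link_state \<Rightarrow> real \<Rightarrow> ennreal" where
  "eve_secure_given P T j r = (\<integral>\<^sup>+x. (\<integral>\<^sup>+y. indicator {..T} (tx_power P * x * path_loss P j r * y / noise_power P)
     \<partial>gamma_law (real (fading_shape P j))) \<partial>array_gain_law P)"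

definition eve_secure :: "network_params \<Rightarrow> real \<Rightarrow> real \<Rightarrow> ennreal" where
  "eve_secure P T r = (\<integral>\<^sup>+j. eve_secure_given P T j r \<partial>link_state_law P r)"

lemma nn_integral_array_gain_law:
  assumes P: "valid_params P" and [measurable]: "f \<in> borel_measurable borel"
  shows "(\<integral>\<^sup>+x. f x \<partial>array_gain_law P) =
    f (array_gain P Main) * ennreal (lobe_prob P Main) + f (array_gain P Side) * ennreal (lobe_prob P Side)"
  using valid_paramsD(11)[OF P, of Main] valid_paramsD(11)[OF P, of Side] valid_paramsD(12)[OF P]
  by (simp add: array_gain_law_def nn_integral_distr nn_integral_bernoulli_pmf)
     (metis add_diff_cancel_left')

lemma nn_integral_link_state_law:
  assumes P: "valid_params P"
  shows "(\<integral>\<^sup>+j. f j \<partial>link_state_law P r) =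
    f LOS * ennreal (los_prob P r) + f NLOS * ennreal (1 - los_prob P r)"
  using valid_paramsD(5,6)[OF P]
  by (simp add: link_state_law_def los_prob_def nn_integral_bernoulli_pmf)

text \<open>The SNR is linear in the fading gain, so a bound T on the SNR is a bound r^a / (V C_j t)
  on the gain, with t = P_t / (T N_0); this is where the argument of \<open>Lambda_E\<close> comes
  from. Distance 0 is excluded because \<open>0 powr (- a) = 0\<close> makes the SNR vanish there,
  while the right side would be 0.\<close>

lemma eve_secure_given_eq:
  assumes P: "valid_params P" and T: "0 < T" and r: "0 < r"
  shows "eve_secure_given P T j r = ennreal (1 - (\<Sum>v\<in>{Main, Side}. lobe_prob P v *
    erlang_tail (fading_shape P j)
      (r powr pl_exponent P j / (array_gain P v * pl_const P j * (tx_power P / (T * noise_power P))))))"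
proof -
  note pos = valid_paramsD[OF P]
  define t where "t = tx_power P / (T * noise_power P)"
  define y where "y v = r powr pl_exponent P j / (array_gain P v * pl_const P j * t)" for v
  have y: "0 \<le> y v" for v
    using pos T by (simp add: y_def t_def less_imp_le)
  have I: "(\<integral>\<^sup>+g. indicator {..T} (tx_power P * array_gain P v * path_loss P j r * g / noise_power P)
     \<partial>gamma_law (real (fading_shape P j))) = ennreal (1 - erlang_tail (fading_shape P j) (y v))" for v
  proof -
    have "indicator {..T} (tx_power P * array_gain P v * path_loss P j r * g / noise_power P) =
        (indicator {..y v} g :: ennreal)" for g
    proof -
      define d where "d = tx_power P * array_gain P v * pl_const P j"
      have d: "0 < d"
        using pos by (simp add: d_def)
      have "tx_power P * array_gain P v * path_loss P j r * g / noise_power P = d * g / (r powr pl_exponent P j * noise_power P)"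
        using r by (simp add: path_loss_def d_def powr_minus divide_simps)
      moreover have "y v = r powr pl_exponent P j * T * noise_power P / d"
        using pos T by (simp add: y_def t_def d_def divide_simps)
      ultimately show ?thesis
        using pos(2) r d by (simp add: indicator_def divide_le_eq le_divide_eq mult_ac)
    qed
    then show ?thesis
      using emeasure_gamma_law_atMost[OF pos(9) y, of j v] by (simp add: erlang_tail_def)
  qed
  have b: "0 \<le> 1 - erlang_tail (fading_shape P j) (y v)" for v
    using erlang_tail_bounds(2)[OF pos(9) y] by simp
  have "eve_secure_given P T j r = ennreal (1 - erlang_tail (fading_shape P j) (y Main)) * ennreal (lobe_prob P Main) +
      ennreal (1 - erlang_tail (fading_shape P j) (y Side)) * ennreal (lobe_prob P Side)"
    unfolding eve_secure_given_def
  proof (subst nn_integral_array_gain_law[OF P])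
    interpret prob_space "gamma_law (real (fading_shape P j))"
      using pos by (intro prob_space_gamma_law)
    show "(\<lambda>x. \<integral>\<^sup>+g. indicator {..T} (tx_power P * x * path_loss P j r * g / noise_power P)
        \<partial>gamma_law (real (fading_shape P j))) \<in> borel_measurable borel"
      by measurable
  qed (simp only: I)
  also have "\<dots> = ennreal ((1 - erlang_tail (fading_shape P j) (y Main)) * lobe_prob P Main +
      (1 - erlang_tail (fading_shape P j) (y Side)) * lobe_prob P Side)"
    using b pos(11) by (simp add: ennreal_mult' ennreal_plus)
  also have "(1 - erlang_tail (fading_shape P j) (y Main)) * lobe_prob P Main +
      (1 - erlang_tail (fading_shape P j) (y Side)) * lobe_prob P Side =
      1 - (\<Sum>v\<in>{Main, Side}. lobe_prob P v * erlang_tail (fading_shape P j) (y v))"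
    using pos(12) by (simp add: algebra_simps)
  finally show ?thesis
    by (simp only: y_def t_def)
qed

lemma eve_secure_given_le_1:
  assumes P: "valid_params P"
  shows "eve_secure_given P T j r \<le> 1"
proof -
  interpret G: prob_space "gamma_law (real (fading_shape P j))"
    using valid_paramsD[OF P] by (intro prob_space_gamma_law)
  interpret A: prob_space "array_gain_law P"
    by (rule prob_space_array_gain_law)
  have "(\<integral>\<^sup>+y. indicator {..T} (tx_power P * x * path_loss P j r * y / noise_power P)
      \<partial>gamma_law (real (fading_shape P j))) \<le> (\<integral>\<^sup>+y. 1 \<partial>gamma_law (real (fading_shape P j)))" for x
    by (intro nn_integral_mono) (simp add: indicator_def)
  then have "eve_secure_given P T j r \<le> (\<integral>\<^sup>+x. 1 \<partial>array_gain_law P)"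
    unfolding eve_secure_given_def by (intro nn_integral_mono) (simp add: G.emeasure_space_1)
  then show ?thesis
    by (simp add: A.emeasure_space_1)
qed

lemma eve_secure_le_1:
  assumes P: "valid_params P"
  shows "eve_secure P T r \<le> 1"
proof -
  have "eve_secure P T r \<le> (\<integral>\<^sup>+j. 1 \<partial>link_state_law P r)"
    unfolding eve_secure_def by (intro nn_integral_mono eve_secure_given_le_1[OF P])
  then show ?thesis
    by (simp add: link_state_law_def measure_pmf.emeasure_space_1)
qed

lemma borel_measurable_eve_secure_given:
  assumes P: "valid_params P"
  shows "eve_secure_given P T j \<in> borel_measurable borel"
proof -
  interpret G: prob_space "gamma_law (real (fading_shape P j))"
    using valid_paramsD[OF P] by (intro prob_space_gamma_law)
  interpret A: prob_space "array_gain_law P"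
    by (rule prob_space_array_gain_law)
  show ?thesis
    unfolding eve_secure_given_def[abs_def] by measurable
qed

lemma borel_measurable_eve_secure:
  assumes P: "valid_params P"
  shows "eve_secure P T \<in> borel_measurable borel"
  unfolding eve_secure_def[abs_def] nn_integral_link_state_law[OF P] los_prob_def
  using borel_measurable_eve_secure_given[OF P] by measurable

lemma eve_secure_eq:
  fixes P :: network_params and T :: real
  defines "e \<equiv> \<lambda>j v r. lobe_prob P v * erlang_tail (fading_shape P j)
      (r powr pl_exponent P j / (array_gain P v * pl_const P j * (tx_power P / (T * noise_power P))))"
  assumes P: "valid_params P" and T: "0 < T" and r: "0 < r"
  shows "1 - enn2real (eve_secure P T r) =
    los_prob P r * (e LOS Main r + e LOS Side r) + (1 - los_prob P r) * (e NLOS Main r + e NLOS Side r)"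
proof -
  note pos = valid_paramsD[OF P]
  let ?s = "\<lambda>j. e j Main r + e j Side r"
  have eq: "eve_secure_given P T j r = ennreal (1 - ?s j)" for j
    using eve_secure_given_eq[OF P T r, of j] by (simp add: e_def)
  have y: "0 \<le> r powr pl_exponent P j / (array_gain P v * pl_const P j * (tx_power P / (T * noise_power P)))" for j v
    using pos T by (simp add: less_imp_le)
  have "e j v r \<le> lobe_prob P v * 1" for j v
    unfolding e_def using erlang_tail_bounds(2)[OF pos(9) y] pos(11) by (intro mult_left_mono) auto
  from this[of _ Main] this[of _ Side] have s: "?s j \<le> 1" for j
    using pos(12) by (metis add_mono mult.right_neutral)
  have l: "0 \<le> los_prob P r" "los_prob P r \<le> 1"
    using pos by (auto simp: los_prob_def)
  have "eve_secure P T r = ennreal ((1 - ?s LOS) * los_prob P r + (1 - ?s NLOS) * (1 - los_prob P r))"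
    unfolding eve_secure_def nn_integral_link_state_law[OF P] eq
    using l s by (simp add: ennreal_mult' ennreal_plus)
  moreover have "0 \<le> (1 - ?s LOS) * los_prob P r + (1 - ?s NLOS) * (1 - los_prob P r)"
    using l s by (intro add_nonneg_nonneg mult_nonneg_nonneg) simp_all
  ultimately have "enn2real (eve_secure P T r) = (1 - ?s LOS) * los_prob P r + (1 - ?s NLOS) * (1 - los_prob P r)"
    by (simp del: ennreal_plus)
  then show ?thesis
    by (simp add: algebra_simps)
qed

text \<open>Up to distance D a link is LOS with probability C and NLOS with probability 1 - C,
  beyond it always NLOS; hence the weights, and an outer term for NLOS alone.
  \<open>Lambda_E\<close> contains the factor \<open>eve_intensity P\<close>, which is divided out
  here and returns with the generating functional. The integrands agree away from the
  origin.\<close>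

lemma has_bochner_integral_eve_insecure:
  assumes P: "valid_params P" and T: "0 < T"
  shows "has_bochner_integral lborel (\<lambda>z::real^2. 1 - enn2real (eve_secure P T (norm z)))
    (Lambda_E P (tx_power P / (T * noise_power P)) / eve_intensity P)"
proof -
  note pos = valid_paramsD[OF P]
  let ?t = "tx_power P / (T * noise_power P)"
  let ?e = "\<lambda>j v r. erlang_tail (fading_shape P j) (r powr pl_exponent P j / (array_gain P v * pl_const P j * ?t))"
  let ?in = "\<lambda>j v z. lobe_prob P v * (indicator {..los_radius P} (norm (z :: real^2)) * ?e j v (norm z))"
  let ?out = "\<lambda>j v z. lobe_prob P v * (indicator {los_radius P<..} (norm (z :: real^2)) * ?e j v (norm z))"
  have t: "0 < ?t"
    using pos T by simp
  note I = has_bochner_integral_Omega[OF P t]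
  have "has_bochner_integral lborel
      (\<lambda>z. state_weight P LOS * (?in LOS Main z + ?in LOS Side z) +
        state_weight P NLOS * (?in NLOS Main z + ?in NLOS Side z) + (?out NLOS Main z + ?out NLOS Side z))
      (state_weight P LOS * (2 * pi * Omega_in P LOS Main ?t + 2 * pi * Omega_in P LOS Side ?t) +
        state_weight P NLOS * (2 * pi * Omega_in P NLOS Main ?t + 2 * pi * Omega_in P NLOS Side ?t) +
        (2 * pi * Omega_out P NLOS Main ?t + 2 * pi * Omega_out P NLOS Side ?t))"
    by (intro has_bochner_integral_add has_bochner_integral_mult_right I)
  also have "(state_weight P LOS * (2 * pi * Omega_in P LOS Main ?t + 2 * pi * Omega_in P LOS Side ?t) +
        state_weight P NLOS * (2 * pi * Omega_in P NLOS Main ?t + 2 * pi * Omega_in P NLOS Side ?t) +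
        (2 * pi * Omega_out P NLOS Main ?t + 2 * pi * Omega_out P NLOS Side ?t)) =
      Lambda_E P ?t / eve_intensity P"
    using pos(3) by (simp add: Lambda_E_def field_simps)
  finally show ?thesis
  proof (rule has_bochner_integralI_AE)
    show "(\<lambda>z::real^2. 1 - enn2real (eve_secure P T (norm z))) \<in> borel_measurable lborel"
      using measurable_compose[OF _ borel_measurable_eve_secure[OF P], of norm lborel T] by measurable
    show "AE z in lborel. state_weight P LOS * (?in LOS Main z + ?in LOS Side z) +
        state_weight P NLOS * (?in NLOS Main z + ?in NLOS Side z) + (?out NLOS Main z + ?out NLOS Side z) =
        1 - enn2real (eve_secure P T (norm z))"
      using AE_lborel_singleton[of "0::real^2"]
    proof eventually_elim
      case (elim z)
      then show ?case
        by (subst eve_secure_eq[OF P T]) (auto simp: state_weight_def los_prob_def indicator_def)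
    qed
  qed
qed

section \<open>Secrecy probability\<close>

text \<open>Serves eavesdroppers whose SNR uses two gains, array gain and fading: one family is
  integrated with the other held fixed.\<close>

lemma nn_integral_PiM_prod_pairs:
  fixes K :: "'i \<Rightarrow> 'x measure" and f g :: "'a \<Rightarrow> 'i"
  assumes K: "\<And>i. prob_space (K i)" and fg: "inj f" "inj g" "range f \<inter> range g = {}"
    and J: "finite J"
    and h: "\<And>k. k \<in> J \<Longrightarrow> (\<lambda>(s, t). h k s t) \<in> borel_measurable (K (f k) \<Otimes>\<^sub>M K (g k))"
  shows "(\<integral>\<^sup>+y. (\<Prod>k\<in>J. h k (y (f k)) (y (g k))) \<partial>PiM UNIV K) =
    (\<Prod>k\<in>J. \<integral>\<^sup>+s. (\<integral>\<^sup>+t. h k s t \<partial>K (g k)) \<partial>K (f k))"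
proof -
  have m: "(\<lambda>(u, v). \<Prod>k\<in>J. h k (u k) (v k)) \<in>
      borel_measurable (PiM UNIV (\<lambda>a. K (f a)) \<Otimes>\<^sub>M PiM UNIV (\<lambda>b. K (g b)))"
    unfolding case_prod_unfold
  proof (rule borel_measurable_prod_ennreal)
    fix k assume k: "k \<in> J"
    have "(\<lambda>x. (fst x k, snd x k)) \<in> PiM UNIV (\<lambda>a. K (f a)) \<Otimes>\<^sub>M PiM UNIV (\<lambda>b. K (g b)) \<rightarrow>\<^sub>M K (f k) \<Otimes>\<^sub>M K (g k)"
      by measurable
    from measurable_compose[OF this h[OF k]]
    show "(\<lambda>x. h k (fst x k) (snd x k)) \<in> borel_measurable (PiM UNIV (\<lambda>a. K (f a)) \<Otimes>\<^sub>M PiM UNIV (\<lambda>b. K (g b)))"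
      by simp
  qed
  have "(\<integral>\<^sup>+y. (\<Prod>k\<in>J. h k (y (f k)) (y (g k))) \<partial>PiM UNIV K) =
      (\<integral>\<^sup>+u. (\<integral>\<^sup>+v. (\<Prod>k\<in>J. h k (u k) (v k)) \<partial>PiM UNIV (\<lambda>b. K (g b))) \<partial>PiM UNIV (\<lambda>a. K (f a)))"
    by (rule nn_integral_PiM_split[OF K fg m])
  also have "\<dots> = (\<integral>\<^sup>+u. (\<Prod>k\<in>J. \<integral>\<^sup>+t. h k (u k) t \<partial>K (g k)) \<partial>PiM UNIV (\<lambda>a. K (f a)))"
  proof (intro nn_integral_cong nn_integral_PiM_prod K J)
    fix u k assume u: "u \<in> space (PiM UNIV (\<lambda>a. K (f a)))" and k: "k \<in> J"
    then have "u k \<in> space (K (f k))"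
      by (simp add: space_PiM PiE_iff)
    from measurable_compose[OF measurable_Pair1'[OF this] h[OF k]]
    show "h k (u k) \<in> borel_measurable (K (g k))"
      by simp
  qed simp
  also have "\<dots> = (\<Prod>k\<in>J. \<integral>\<^sup>+s. (\<integral>\<^sup>+t. h k s t \<partial>K (g k)) \<partial>K (f k))"
  proof (intro nn_integral_PiM_prod K J)
    fix k assume k: "k \<in> J"
    interpret prob_space "K (g k)"
      by (rule K)
    show "(\<lambda>s. \<integral>\<^sup>+t. h k s t \<partial>K (g k)) \<in> borel_measurable (K (f k))"
      using borel_measurable_nn_integral_fst[OF h[OF k]] by simp
  qed simp
  finally show ?thesis .
qed

lemma measurable_sequence_at:
  assumes "\<And>n::nat. (\<lambda>w. x w n) \<in> M \<rightarrow>\<^sub>M N" "i \<in> M \<rightarrow>\<^sub>M count_space UNIV"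
  shows "(\<lambda>w. x w (i w)) \<in> M \<rightarrow>\<^sub>M N"
  using assms by (rule measurable_compose_countable)

lemma borel_measurable_eve_secure_given_pair:
  assumes P: "valid_params P" and "g \<in> M \<rightarrow>\<^sub>M count_space UNIV" and [measurable]: "r \<in> borel_measurable M"
  shows "(\<lambda>x. eve_secure_given P T (g x) (r x)) \<in> borel_measurable M"
  using assms(2) by (rule measurable_apply_link_state)
    (intro measurable_compose[OF _ borel_measurable_eve_secure_given[OF P]] assms)

lemma prob_space_link_state_law: "prob_space (link_state_law P r)"
  unfolding link_state_law_def by (rule measure_pmf.prob_space_axioms)

lemma sets_link_state_law [simp, measurable_cong]: "sets (link_state_law P r) = sets (count_space UNIV)"
  by (simp add: link_state_law_def)

lemma prob_space_gain_law:
  assumes "valid_params P"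
  shows "prob_space (gain_law P i w)" "sets (gain_law P i w) = sets borel"
proof -
  obtain xz s where w: "w = (xz, s)"
    by fastforce
  show "prob_space (gain_law P i w)" "sets (gain_law P i w) = sets borel"
    using valid_paramsD(9)[OF assms]
    by (cases i; simp add: w prob_space_gamma_law prob_space_array_gain_law)+
qed

lemma nn_integral_gain_law_eve:
  fixes w :: "((nat \<Rightarrow> real^2) \<times> (nat \<Rightarrow> real^2)) \<times> (link \<Rightarrow> link_state)"
  assumes P: "valid_params P"
  shows "(\<integral>\<^sup>+y. (\<Prod>k<K. indicator {..T}
      (tx_power P * y (Eve_Array_Gain k) * path_loss P (snd w (Eve_Link (serving_index P (fst w) (snd w)) k)) (d k) *
       y (Eve_Fading k) / noise_power P)) \<partial>PiM UNIV (\<lambda>i. gain_law P i w)) =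
    (\<Prod>k<K. eve_secure_given P T (snd w (Eve_Link (serving_index P (fst w) (snd w)) k)) (d k))"
proof -
  have G: "gain_law P (Eve_Array_Gain k) w = array_gain_law P"
    "gain_law P (Eve_Fading k) w =
      gamma_law (real (fading_shape P (snd w (Eve_Link (serving_index P (fst w) (snd w)) k))))" for k
    by (cases w; simp)+
  let ?h = "\<lambda>k x y. indicator {..T} (tx_power P * x *
      path_loss P (snd w (Eve_Link (serving_index P (fst w) (snd w)) k)) (d k) * y / noise_power P) :: ennreal"
  have "(\<integral>\<^sup>+y. (\<Prod>k<K. ?h k (y (Eve_Array_Gain k)) (y (Eve_Fading k))) \<partial>PiM UNIV (\<lambda>i. gain_law P i w)) =
      (\<Prod>k<K. \<integral>\<^sup>+x. (\<integral>\<^sup>+y. ?h k x y \<partial>gain_law P (Eve_Fading k) w) \<partial>gain_law P (Eve_Array_Gain k) w)"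
    by (rule nn_integral_PiM_prod_pairs[OF prob_space_gain_law(1)[OF P]])
      (auto simp: inj_on_def measurable_cong_sets[OF sets_pair_measure_cong[OF prob_space_gain_law(2)[OF P]
        prob_space_gain_law(2)[OF P]] refl])
  then show ?thesis
    by (simp add: G eve_secure_given_def)
qed

text \<open>Once the user links are fixed, so is the serving index i. The links from i to different
  eavesdroppers are distinct coordinates, so their product integrates factor by factor and each
  factor averages to \<open>eve_secure\<close>. The inner family is indexed by pairs because any
  base station may turn out to be i.\<close>

lemma nn_integral_link_states:
  assumes P: "valid_params P"
  shows "(\<integral>\<^sup>+s. (\<Prod>k<K. eve_secure_given P T (s (Eve_Link (serving_index P (x, z) s) k))
        (dist (x (serving_index P (x, z) s)) (z k))) \<partial>PiM UNIV (\<lambda>l. link_state_law P (link_length (x, z) l))) =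
    (\<integral>\<^sup>+u. (\<Prod>k<K. eve_secure P T (dist (x (user_serving_index P x u)) (z k)))
      \<partial>PiM UNIV (\<lambda>n. link_state_law P (norm (x n))))"
proof -
  let ?L = "\<lambda>l. link_state_law P (link_length (x, z) l)"
  let ?e = "\<lambda>(n, k). Eve_Link n k"
  let ?A = "PiM UNIV (\<lambda>_. count_space UNIV) \<Otimes>\<^sub>M PiM UNIV (\<lambda>_. count_space UNIV) ::
    ((nat \<Rightarrow> link_state) \<times> (nat \<times> nat \<Rightarrow> link_state)) measure"
  let ?B = "PiM UNIV (\<lambda>n. ?L (User_Link n)) \<Otimes>\<^sub>M PiM UNIV (\<lambda>nk. ?L (?e nk))"
  have sets: "sets ?B = sets ?A"
    by (intro sets_pair_measure_cong sets_PiM_cong) auto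
  have "(\<lambda>w. eve_secure_given P T (snd w (user_serving_index P x (fst w), k)) (dist (x (user_serving_index P x (fst w))) (z k)))
      \<in> borel_measurable ?A" for k
  proof -
    have i: "(\<lambda>w. user_serving_index P x (fst w)) \<in> ?A \<rightarrow>\<^sub>M count_space UNIV"
      by (intro measurable_user_serving_index) measurable
    have "(\<lambda>w. snd w (user_serving_index P x (fst w), k)) \<in> ?A \<rightarrow>\<^sub>M count_space UNIV"
      by (rule measurable_compose_countable[OF _ i]) measurable
    moreover have "(\<lambda>w. dist (x (user_serving_index P x (fst w))) (z k)) \<in> borel_measurable ?A"
      by (rule measurable_compose[OF i]) simp
    ultimately show ?thesis
      by (rule borel_measurable_eve_secure_given_pair[OF P])
  qed
  then have meas: "(\<lambda>w. eve_secure_given P T (snd w (user_serving_index P x (fst w), k)) (dist (x (user_serving_index P x (fst w))) (z k)))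
      \<in> borel_measurable ?B" for k
    by (simp only: measurable_cong_sets[OF sets refl])
  have "(\<integral>\<^sup>+s. (\<Prod>k<K. eve_secure_given P T (s (Eve_Link (serving_index P (x, z) s) k))
        (dist (x (serving_index P (x, z) s)) (z k))) \<partial>PiM UNIV ?L) =
      (\<integral>\<^sup>+s. (\<lambda>u v. \<Prod>k<K. eve_secure_given P T (v (user_serving_index P x u, k))
        (dist (x (user_serving_index P x u)) (z k))) (\<lambda>n. s (User_Link n)) (\<lambda>nk. s (?e nk)) \<partial>PiM UNIV ?L)"
    by (simp add: serving_index_eq)
  also have "\<dots> = (\<integral>\<^sup>+u. (\<integral>\<^sup>+v. (\<Prod>k<K. eve_secure_given P T (v (user_serving_index P x u, k))
        (dist (x (user_serving_index P x u)) (z k))) \<partial>PiM UNIV (\<lambda>nk. ?L (?e nk))) \<partial>PiM UNIV (\<lambda>n. ?L (User_Link n)))"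
    by (rule nn_integral_PiM_split[OF prob_space_link_state_law])
      (use meas in \<open>auto simp: inj_on_def case_prod_unfold intro!: borel_measurable_prod_ennreal\<close>)
  also have "\<dots> = (\<integral>\<^sup>+u. (\<Prod>k<K. eve_secure P T (dist (x (user_serving_index P x u)) (z k)))
      \<partial>PiM UNIV (\<lambda>n. ?L (User_Link n)))"
    unfolding eve_secure_def
    by (intro nn_integral_cong trans[OF nn_integral_PiM_prod[OF prob_space_link_state_law]])
      (auto simp: inj_on_def link_length_def cong: measurable_cong_sets)
  finally show ?thesis
    by (simp add: link_length_def)
qed

text \<open>The generating functional applied to the failure probability seen from a transmitter at
  \<open>v\<close>. Its exponent is an integral over the whole plane, so translating by
  \<open>v\<close> does not change it and the value is the same for every \<open>v\<close>.\<close>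

lemma INF_nn_integral_eve_secure:
  fixes v :: "real^2" and Z :: "nat \<Rightarrow> 'w \<Rightarrow> real^2"
  assumes M: "prob_space M" and P: "valid_params P" and T: "0 < T"
    and PPP: "homogeneous_PPP M (eve_intensity P) (\<lambda>\<omega>. range (\<lambda>k. Z k \<omega>))"
    and inj: "AE \<omega> in M. inj (\<lambda>k. Z k \<omega>)"
    and Z[measurable]: "\<And>k. Z k \<in> M \<rightarrow>\<^sub>M borel"
  shows "(INF K. \<integral>\<^sup>+\<omega>. (\<Prod>k<K. eve_secure P T (dist v (Z k \<omega>))) \<partial>M) =
    ennreal (exp (- Lambda_E P (tx_power P / (T * noise_power P))))"
proof -
  interpret prob_space M by fact
  note es[measurable] = borel_measurable_eve_secure[OF P]
  define p where "p z = 1 - enn2real (eve_secure P T (norm (z - v)))" for z :: "real^2"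
  have es1: "enn2real (eve_secure P T r) \<le> 1" for r
    using enn2real_mono[OF eve_secure_le_1[OF P, of T r]] by simp
  have p01: "0 \<le> p z" "p z \<le> 1" for z
    using es1 by (auto simp: p_def)
  have es_p: "eve_secure P T (dist v z) = ennreal (1 - p z)" for z
    using eve_secure_le_1[OF P, of T "norm (z - v)"]
    by (auto simp: p_def dist_norm norm_minus_commute ennreal_enn2real_if top_unique)
  let ?I = "Lambda_E P (tx_power P / (T * noise_power P)) / eve_intensity P"
  \<comment> \<open>Lebesgue measure equals its image under translation by \<open>- v\<close>, which
    recentres the integral at the transmitter.\<close>
  have "has_bochner_integral (distr lborel borel (\<lambda>z::real^2. - v + z)) (\<lambda>z::real^2. 1 - enn2real (eve_secure P T (norm z))) ?I"
    using has_bochner_integral_eve_insecure[OF P T] by (simp only: lborel_distr_plus)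
  then have "has_bochner_integral lborel p ?I"
    by (simp add: has_bochner_integral_iff integrable_distr_eq integral_distr p_def[abs_def])
  then have int: "integrable lborel p" "(\<integral>z. p z \<partial>lborel) = ?I"
    by (auto simp: has_bochner_integral_iff)
  have prod: "(\<Prod>k<K. eve_secure P T (dist v (Z k \<omega>))) = ennreal (\<Prod>k<K. 1 - p (Z k \<omega>))" for K \<omega>
    unfolding es_p using p01 by (intro prod_ennreal) simp
  have pm[measurable]: "p \<in> borel_measurable borel"
    unfolding p_def[abs_def] by measurable
  have "(INF K. \<integral>\<^sup>+\<omega>. ennreal (\<Prod>k<K. 1 - p (Z k \<omega>)) \<partial>M) =
      (\<integral>\<^sup>+\<omega>. (INF K. ennreal (\<Prod>k<K. 1 - p (Z k \<omega>))) \<partial>M)"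
  proof (rule nn_integral_monotone_convergence_INF_decseq[symmetric, where i = 0])
    show "decseq (\<lambda>K \<omega>. ennreal (\<Prod>k<K. 1 - p (Z k \<omega>)))"
      using p01 by (intro decseq_SucI le_funI ennreal_leI) (auto intro!: mult_left_le prod_nonneg)
  qed (auto simp: emeasure_space_1)
  also have "\<dots> = ennreal (exp (- (eve_intensity P * ?I)))"
    using homogeneous_PPP_pgfl[OF PPP inj Z _ int(1) p01] valid_paramsD(3)[OF P] by (simp add: int(2))
  finally show ?thesis
    using valid_paramsD(3)[OF P] by (simp add: prod)
qed

section \<open>Consequences of the network hypotheses and measurability of its random
  variables\<close>

lemma is_networkD:
  assumes "is_network M P W"
  shows "prob_space M"
    and "homogeneous_PPP M (bs_intensity P) (\<lambda>\<omega>. range (\<lambda>n. bs W n \<omega>))"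
    and "homogeneous_PPP M (eve_intensity P) (\<lambda>\<omega>. range (\<lambda>k. eve W k \<omega>))"
    and "AE \<omega> in M. inj (\<lambda>k. eve W k \<omega>)"
    and "prob_space.indep_var M config_space (\<lambda>\<omega> n. bs W n \<omega>) config_space (\<lambda>\<omega> k. eve W k \<omega>)"
    and "cond_indep_laws M (config_space \<Otimes>\<^sub>M config_space) (locations W)
       (count_space UNIV) (state W) (\<lambda>l xz. link_state_law P (link_length xz l))"
    and "cond_indep_laws M ((config_space \<Otimes>\<^sub>M config_space) \<Otimes>\<^sub>M state_space)
       (\<lambda>\<omega>. (locations W \<omega>, states W \<omega>)) borel (gain W) (gain_law P)"
  using assms by (auto simp: is_network_def)

lemma measurable_network:
  assumes W: "is_network M P W"
  shows measurable_locations: "locations W \<in> M \<rightarrow>\<^sub>M config_space \<Otimes>\<^sub>M config_space"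
    and measurable_bs: "\<And>n. bs W n \<in> borel_measurable M"
    and measurable_eve: "\<And>k. eve W k \<in> borel_measurable M"
    and measurable_state: "\<And>l. state W l \<in> M \<rightarrow>\<^sub>M count_space UNIV"
    and measurable_gain: "\<And>i. gain W i \<in> borel_measurable M"
    and measurable_serving: "serving P W \<in> M \<rightarrow>\<^sub>M count_space UNIV"
    and measurable_serving_state: "serving_state P W \<in> M \<rightarrow>\<^sub>M count_space UNIV"
    and measurable_serving_distance: "serving_distance P W \<in> borel_measurable M"
proof -
  show L: "locations W \<in> M \<rightarrow>\<^sub>M config_space \<Otimes>\<^sub>M config_space" and S[measurable]: "\<And>l. state W l \<in> M \<rightarrow>\<^sub>M count_space UNIV"
    and "\<And>i. gain W i \<in> borel_measurable M"
    using is_networkD(6,7)[OF W] by (auto simp: cond_indep_laws_def)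
  have "(\<lambda>\<omega>. fst (locations W \<omega>) n) \<in> borel_measurable M" "(\<lambda>\<omega>. snd (locations W \<omega>) n) \<in> borel_measurable M" for n
    using L by measurable
  then show B[measurable]: "\<And>n. bs W n \<in> borel_measurable M" and "\<And>k. eve W k \<in> borel_measurable M"
    by (simp_all add: locations_def)
  show s: "serving P W \<in> M \<rightarrow>\<^sub>M count_space UNIV"
    unfolding serving_def[abs_def] serving_index_eq by (simp add: locations_def states_def)
  show "serving_state P W \<in> M \<rightarrow>\<^sub>M count_space UNIV"
    unfolding serving_state_def[abs_def] by (rule measurable_sequence_at[OF _ s]) measurable
  show "serving_distance P W \<in> borel_measurable M"
    unfolding serving_distance_def[abs_def] by (rule measurable_compose_countable[OF _ s]) measurable
qed

text \<open>The events that the first K eavesdroppers fail decrease to the secrecy event.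
  Integrating out gains and eavesdropper links leaves an average of \<open>g K\<close> over the
  position of the serving base station, and the infimum of \<open>g K\<close> over K is one constant
  at all positions.\<close>

lemma secrecy_prob_eq:
  assumes P: "valid_params P" and W: "is_network M P W" and T: "0 < T"
  shows "secrecy_prob M P W T = exp (- Lambda_E P (tx_power P / (T * noise_power P)))"
proof -
  interpret prob_space M
    by (rule is_networkD(1)[OF W])
  note [measurable] = measurable_network[OF W]
  let ?N = "config_space \<Otimes>\<^sub>M config_space"
  let ?n = "\<lambda>w. serving_index P (fst w) (snd w)"
  define d where "d w k = dist (fst (fst w) (?n w)) (snd (fst w) k)"
    for w :: "((nat \<Rightarrow> real^2) \<times> (nat \<Rightarrow> real^2)) \<times> (link \<Rightarrow> link_state)" and k :: nat
  define snr where "snr w y k = tx_power P * y (Eve_Array_Gain k) *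
      path_loss P (snd w (Eve_Link (?n w) k)) (d w k) * y (Eve_Fading k) / noise_power P"
    for w :: "((nat \<Rightarrow> real^2) \<times> (nat \<Rightarrow> real^2)) \<times> (link \<Rightarrow> link_state)" and y k
  let ?w = "\<lambda>\<omega>. (locations W \<omega>, states W \<omega>)"
  have SNR: "SNR_eve P W k \<omega> = snr (?w \<omega>) (\<lambda>i. gain W i \<omega>) k" for k \<omega>
    by (simp add: SNR_eve_def snr_def d_def serving_def locations_def states_def)
  have i: "?n \<in> ?N \<Otimes>\<^sub>M state_space \<rightarrow>\<^sub>M count_space UNIV"
    using measurable_serving_index[of P] by (simp add: case_prod_unfold)
  have st: "(\<lambda>w. snd w (Eve_Link (?n w) k)) \<in> ?N \<Otimes>\<^sub>M state_space \<rightarrow>\<^sub>M count_space UNIV" for k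
    by (rule measurable_compose_countable[OF _ i]) measurable
  have d[measurable]: "(\<lambda>w. d w k) \<in> borel_measurable (?N \<Otimes>\<^sub>M state_space)" for k
    unfolding d_def by (rule measurable_compose_countable[OF _ i]) measurable
  have snr[measurable]: "(\<lambda>(w, y). snr w y k) \<in> borel_measurable ((?N \<Otimes>\<^sub>M state_space) \<Otimes>\<^sub>M PiM UNIV (\<lambda>_. borel))" for k
    unfolding snr_def using measurable_compose[OF measurable_fst st[of k]] by measurable
  have w[measurable]: "?w \<in> M \<rightarrow>\<^sub>M ?N \<Otimes>\<^sub>M state_space"
    using is_networkD(7)[OF W] by (simp add: cond_indep_laws_def)
  have gm[measurable]: "(\<lambda>\<omega> i. gain W i \<omega>) \<in> M \<rightarrow>\<^sub>M PiM UNIV (\<lambda>_. borel)"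
    by (rule measurable_PiM_single') auto
  have SNRm[measurable]: "SNR_eve P W k \<in> borel_measurable M" for k
    unfolding SNR using measurable_compose[OF measurable_Pair[OF w gm] snr[of k]] by simp
  define E where "E K = {\<omega>\<in>space M. \<forall>k<K. SNR_eve P W k \<omega> \<le> T}" for K
  have E[measurable]: "E K \<in> sets M" for K
    unfolding E_def by measurable

  define \<mu> where "\<mu> = distr M config_space (\<lambda>\<omega> n. bs W n \<omega>)"
  define \<nu> where "\<nu> = distr M config_space (\<lambda>\<omega> k. eve W k \<omega>)"
  have loc_law: "distr M ?N (locations W) = \<mu> \<Otimes>\<^sub>M \<nu>"
    using is_networkD(5)[OF W] unfolding indep_var_distribution_eq locations_def[abs_def] \<mu>_def \<nu>_def by simp
  have bsm[measurable]: "(\<lambda>\<omega> n. bs W n \<omega>) \<in> M \<rightarrow>\<^sub>M config_space" and evem[measurable]: "(\<lambda>\<omega> k. eve W k \<omega>) \<in> M \<rightarrow>\<^sub>M config_space"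
    by (auto intro!: measurable_PiM_single' simp: measurable_network[OF W])
  interpret \<mu>: prob_space \<mu>
    unfolding \<mu>_def by (rule prob_space_distr) measurable
  interpret \<nu>: prob_space \<nu>
    unfolding \<nu>_def by (rule prob_space_distr) measurable
  have sets_\<mu>[measurable_cong]: "sets \<mu> = sets config_space" and [measurable_cong]: "sets \<nu> = sets config_space"
    by (simp_all add: \<mu>_def \<nu>_def)
  let ?U = "\<lambda>x. PiM UNIV (\<lambda>n. link_state_law P (norm (x n)))"
  let ?S = "PiM UNIV (\<lambda>_::nat. count_space (UNIV :: link_state set))"
  have Um[measurable]: "?U \<in> config_space \<rightarrow>\<^sub>M prob_algebra ?S"
    by (rule measurable_PiM_kernel) measurable
  have Us[measurable_cong]: "sets (?U x) = sets ?S" for x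
    by (intro sets_PiM_cong) auto
  define x_star where "x_star x u = x (user_serving_index P x u)"
    for x :: "nat \<Rightarrow> real^2" and u :: "nat \<Rightarrow> link_state"
  have xm[measurable]: "(\<lambda>(x, u). x_star x u) \<in> borel_measurable (config_space \<Otimes>\<^sub>M ?S)"
  proof -
    have "(\<lambda>w. user_serving_index P (fst w) (snd w)) \<in> config_space \<Otimes>\<^sub>M ?S \<rightarrow>\<^sub>M count_space UNIV"
      by (rule measurable_user_serving_index) measurable
    from measurable_sequence_at[OF _ this, of fst] show ?thesis
      by (simp add: x_star_def case_prod_unfold)
  qed
  have x_star: "x_star x \<in> borel_measurable ?S" for x
    using measurable_compose[OF measurable_Pair1'[of x config_space ?S] xm] by (simp add: space_PiM)
  interpret U: prob_space "?U x" for x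
    by (rule prob_space_PiM) (rule prob_space_link_state_law)
  note es[measurable] = borel_measurable_eve_secure[OF P]
  define g where "g K v = (\<integral>\<^sup>+z. (\<Prod>k<K. eve_secure P T (dist v (z k))) \<partial>\<nu>)" for K and v :: "real^2"
  have gmeas[measurable]: "g K \<in> borel_measurable borel" for K
    unfolding g_def[abs_def] by measurable
  have emE: "emeasure M (E K) = (\<integral>\<^sup>+x. (\<integral>\<^sup>+u. g K (x_star x u) \<partial>?U x) \<partial>\<mu>)" for K
  proof -
    let ?H = "\<lambda>xz. \<integral>\<^sup>+u. (\<Prod>k<K. eve_secure P T (dist (x_star (fst xz) u) (snd xz k))) \<partial>?U (fst xz)"
    have Hm: "?H \<in> borel_measurable ?N"
    proof (rule nn_integral_measurable_subprob_algebra2[where N = ?S])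
      have "(\<lambda>w. x_star (fst (fst w)) (snd w)) \<in> borel_measurable (?N \<Otimes>\<^sub>M ?S)"
        using measurable_compose[OF measurable_Pair[OF measurable_compose[OF measurable_fst measurable_fst] measurable_snd] xm]
        by simp
      then show "(\<lambda>(xz, u). \<Prod>k<K. eve_secure P T (dist (x_star (fst xz) u) (snd xz k))) \<in> borel_measurable (?N \<Otimes>\<^sub>M ?S)"
        unfolding case_prod_unfold by measurable
      show "(\<lambda>xz. ?U (fst xz)) \<in> ?N \<rightarrow>\<^sub>M subprob_algebra ?S"
        by (rule measurable_prob_algebraD[OF measurable_compose[OF measurable_fst Um]])
    qed
    have "emeasure M (E K) = (\<integral>\<^sup>+\<omega>. indicator (E K) \<omega> \<partial>M)"
      by simp
    also have "\<dots> = (\<integral>\<^sup>+\<omega>. (\<Prod>k<K. indicator {..T} (snr (?w \<omega>) (\<lambda>i. gain W i \<omega>) k)) \<partial>M)"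
      by (intro nn_integral_cong) (auto simp: E_def SNR indicator_def prod_zero_iff)
    also have "\<dots> = (\<integral>\<^sup>+\<omega>. (\<integral>\<^sup>+y. (\<Prod>k<K. indicator {..T} (snr (?w \<omega>) y k)) \<partial>PiM UNIV (\<lambda>i. gain_law P i (?w \<omega>))) \<partial>M)"
      by (rule cond_indep_laws_nn_integral[OF is_networkD(1)[OF W] is_networkD(7)[OF W] measurable_gain_law[OF P]])
        measurable
    also have "\<dots> = (\<integral>\<^sup>+\<omega>. (\<Prod>k<K. eve_secure_given P T (snd (?w \<omega>) (Eve_Link (?n (?w \<omega>)) k)) (d (?w \<omega>) k)) \<partial>M)"
      unfolding snr_def by (simp only: nn_integral_gain_law_eve[OF P])
    also have "\<dots> = (\<integral>\<^sup>+\<omega>. (\<lambda>xz s. \<Prod>k<K. eve_secure_given P T (s (Eve_Link (?n (xz, s)) k)) (d (xz, s) k))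
        (locations W \<omega>) (\<lambda>l. state W l \<omega>) \<partial>M)"
      by (simp add: states_def)
    also have "\<dots> = (\<integral>\<^sup>+\<omega>. (\<integral>\<^sup>+s. (\<Prod>k<K. eve_secure_given P T (s (Eve_Link (?n (locations W \<omega>, s)) k)) (d (locations W \<omega>, s) k))
        \<partial>PiM UNIV (\<lambda>l. link_state_law P (link_length (locations W \<omega>) l))) \<partial>M)"
    proof (rule cond_indep_laws_nn_integral[OF is_networkD(1)[OF W] is_networkD(6)[OF W]])
      show "(\<lambda>(xz, s). \<Prod>k<K. eve_secure_given P T (s (Eve_Link (?n (xz, s)) k)) (d (xz, s) k))
          \<in> borel_measurable (?N \<Otimes>\<^sub>M state_space)"
        unfolding case_prod_unfold
        using st d by (intro borel_measurable_prod_ennreal borel_measurable_eve_secure_given_pair[OF P]) simp_all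
    qed measurable
    also have "\<dots> = (\<integral>\<^sup>+\<omega>. ?H (locations W \<omega>) \<partial>M)"
      by (intro nn_integral_cong)
        (simp add: d_def x_star_def case_prod_unfold nn_integral_link_states[OF P, where x="fst x" and z="snd x" for x, simplified])
    also have "\<dots> = (\<integral>\<^sup>+xz. ?H xz \<partial>(\<mu> \<Otimes>\<^sub>M \<nu>))"
      unfolding loc_law[symmetric] using Hm by (intro nn_integral_distr[symmetric]) measurable
    also have "\<dots> = (\<integral>\<^sup>+x. (\<integral>\<^sup>+z. ?H (x, z) \<partial>\<nu>) \<partial>\<mu>)"
      using Hm by (intro \<nu>.nn_integral_fst[symmetric]) (simp cong: measurable_cong_sets)
    \<comment> \<open>User links and eavesdropper positions are interchanged. With the base stations
      and user links outside, \<open>x_star x u\<close> is a fixed point of the plane during the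
      integration over the eavesdroppers.\<close>
    also have "\<dots> = (\<integral>\<^sup>+x. (\<integral>\<^sup>+u. g K (x_star x u) \<partial>?U x) \<partial>\<mu>)"
    proof (intro nn_integral_cong)
      fix x :: "nat \<Rightarrow> real^2"
      interpret pair_sigma_finite "?U x" \<nu> ..
      have "(\<lambda>(u, z). \<Prod>k<K. eve_secure P T (dist (x_star x u) (z k))) \<in> borel_measurable (?S \<Otimes>\<^sub>M config_space)"
        using measurable_compose[OF measurable_fst x_star[of x]] unfolding case_prod_unfold by measurable
      then show "(\<integral>\<^sup>+z. ?H (x, z) \<partial>\<nu>) = (\<integral>\<^sup>+u. g K (x_star x u) \<partial>?U x)"
        unfolding g_def by (subst Fubini'[symmetric]) (simp_all cong: measurable_cong_sets)
    qed
    finally show ?thesis .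
  qed
  let ?c = "ennreal (exp (- Lambda_E P (tx_power P / (T * noise_power P))))"
  have INF_g: "(INF K. g K v) = ?c" for v
  proof -
    have "g K v = (\<integral>\<^sup>+\<omega>. (\<Prod>k<K. eve_secure P T (dist v (eve W k \<omega>))) \<partial>M)" for K
      unfolding g_def \<nu>_def by (subst nn_integral_distr) measurable
    then show ?thesis
      using INF_nn_integral_eve_secure[OF is_networkD(1)[OF W] P T is_networkD(3,4)[OF W]] by simp
  qed
  have gdec: "decseq (\<lambda>K. g K v)" for v
    unfolding g_def using eve_secure_le_1[OF P]
    by (intro decseq_SucI nn_integral_mono) (auto intro: mult_left_le)
  have "{\<omega>\<in>space M. (SUP k. ereal (SNR_eve P W k \<omega>)) \<le> ereal T} = (\<Inter>K. E K)"
    by (auto simp: E_def SUP_le_iff)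
  then have "ennreal (secrecy_prob M P W T) = emeasure M (\<Inter>K. E K)"
    by (simp add: secrecy_prob_def emeasure_eq_measure)
  also have "\<dots> = (INF K. emeasure M (E K))"
    by (rule INF_emeasure_decseq[symmetric]) (auto simp: E_def intro!: decseq_SucI)
  also have "\<dots> = (INF K. \<integral>\<^sup>+x. (\<integral>\<^sup>+u. g K (x_star x u) \<partial>?U x) \<partial>\<mu>)"
    by (simp only: emE)
  \<comment> \<open>The infimum has to pass two averages, over base stations and over user links,
    before it reaches \<open>g\<close>.\<close>
  also have "\<dots> = (\<integral>\<^sup>+x. (INF K. \<integral>\<^sup>+u. g K (x_star x u) \<partial>?U x) \<partial>\<mu>)"
  proof (rule nn_integral_monotone_convergence_INF_decseq[symmetric, where i = 0])
    show "decseq (\<lambda>K x. \<integral>\<^sup>+u. g K (x_star x u) \<partial>?U x)"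
      using gdec by (intro antimonoI le_funI nn_integral_mono) (auto dest: antimonoD)
    show "(\<lambda>x. \<integral>\<^sup>+u. g K (x_star x u) \<partial>?U x) \<in> borel_measurable \<mu>" for K
      unfolding measurable_cong_sets[OF sets_\<mu> refl]
    proof (rule nn_integral_measurable_subprob_algebra2[where N = ?S])
      show "(\<lambda>(x, u). g K (x_star x u)) \<in> borel_measurable (config_space \<Otimes>\<^sub>M ?S)"
        using measurable_compose[OF xm gmeas[of K]] by (simp add: case_prod_unfold)
      show "?U \<in> config_space \<rightarrow>\<^sub>M subprob_algebra ?S"
        by (rule measurable_prob_algebraD[OF Um])
    qed
  qed (simp add: g_def U.emeasure_space_1 \<mu>.emeasure_space_1 \<nu>.emeasure_space_1)
  also have "\<dots> = (\<integral>\<^sup>+x. (\<integral>\<^sup>+u. (INF K. g K (x_star x u)) \<partial>?U x) \<partial>\<mu>)"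
  proof (intro nn_integral_cong nn_integral_monotone_convergence_INF_decseq[symmetric, where i = 0])
    fix x :: "nat \<Rightarrow> real^2"
    show "decseq (\<lambda>K u. g K (x_star x u))"
      using gdec by (intro antimonoI le_funI) (auto dest: antimonoD)
    show "(\<lambda>u. g K (x_star x u)) \<in> borel_measurable (?U x)" for K
      using measurable_compose[OF x_star gmeas] by (simp cong: measurable_cong_sets)
  qed (simp add: g_def U.emeasure_space_1 \<nu>.emeasure_space_1)
  also have "\<dots> = ?c"
    by (simp add: INF_g U.emeasure_space_1 \<mu>.emeasure_space_1)
  finally show ?thesis
    by (simp add: secrecy_prob_def)
qed

section \<open>Connection probability\<close>

text \<open>The gamma law has no atoms, so its mass on \<open>{x..}\<close> is one minus its mass on
  \<open>{..x}\<close>. The finite sum makes measurability in x and the bounds 0 and 1 evident,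
  which the integral form does not.\<close>

lemma upper_Gamma_eq_erlang_tail:
  assumes n: "0 < n" and x: "0 \<le> x"
  shows "upper_Gamma (real n) x / Gamma (real n) = erlang_tail n x"
proof -
  interpret prob_space "gamma_law (real n)"
    using n by (rule prob_space_gamma_law)
  have "emeasure (gamma_law (real n)) {x} = 0"
    by (simp add: gamma_law_def emeasure_density nn_integral_indicator_singleton)
  then have "prob {x} = 0"
    by (simp add: measure_def)
  moreover have "prob {..x} + prob {x..} = prob {x} + prob (space (gamma_law (real n)))"
  proof -
    have "prob {..x} = prob {x} + prob {..<x}"
      by (subst finite_measure_Union[symmetric]) (auto intro!: arg_cong[where f = prob])
    moreover have "prob {..<x} + prob {x..} = prob (space (gamma_law (real n)))"
    proof -
      have "{..<x} \<union> {x..} = space (gamma_law (real n))"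
        by (auto simp: gamma_law_def)
      then show ?thesis
        by (subst finite_measure_Union[symmetric]) auto
    qed
    ultimately show ?thesis
      by simp
  qed
  moreover have "prob {..x} = 1 - erlang_tail n x"
    using emeasure_gamma_law_atMost[OF n x] erlang_tail_bounds[OF n x]
    by (simp add: measure_def erlang_tail_def)
  ultimately have "prob {x..} = erlang_tail n x"
    by (simp add: prob_space)
  moreover have "0 \<le> upper_Gamma (real n) x / Gamma (real n)"
    using n by (auto simp: upper_Gamma_def set_lebesgue_integral_def
      intro!: divide_nonneg_pos integral_nonneg_AE Gamma_real_pos)
  then have "prob {x..} = upper_Gamma (real n) x / Gamma (real n)"
    using emeasure_gamma_law_atLeast[OF n x] by (simp add: measure_def)
  ultimately show ?thesis
    by simp
qed

text \<open>The case a = c = 1 of \<open>distr_norm_powr\<close>: under area measure the radius has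
  a density.\<close>

lemma null_sets_norm_vimage:
  assumes N: "N \<in> null_sets lborel"
  shows "{z::real^2. norm z \<in> N} \<in> null_sets lborel"
proof -
  have [measurable]: "N \<in> sets borel"
    using N by auto
  have S: "{z::real^2. norm z \<in> N} \<in> sets borel"
    by measurable
  have "emeasure (distr lborel borel (\<lambda>z::real^2. norm z powr 1 / 1)) N = 0"
    unfolding distr_norm_powr[OF zero_less_one zero_less_one]
    by (subst emeasure_density) (use N in \<open>auto intro!: nn_integral_null_set simp: null_sets_def\<close>)
  then show ?thesis
    using S by (subst (asm) emeasure_distr) (auto simp: null_sets_def vimage_def)
qed

lemma (in prob_space) homogeneous_PPP_AE_avoids_null:
  assumes PPP: "homogeneous_PPP M lam \<Phi>" and A: "A \<in> null_sets lborel"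
  shows "AE \<omega> in M. \<Phi> \<omega> \<inter> A = {}"
proof -
  have "AE \<omega> in M. card (\<Phi> \<omega> \<inter> (A \<inter> ball 0 (real m))) = 0" for m
  proof -
    let ?B = "A \<inter> ball 0 (real m)"
    have B: "?B \<in> sets borel" "bounded ?B"
      using null_setsD2[OF A] by (simp_all add: bounded_Int)
    have "emeasure lborel ?B = 0"
      by (rule emeasure_eq_0[OF _ null_setsD1[OF A]]) (use null_setsD2[OF A] in simp_all)
    then have "measure lborel ?B = 0"
      by (simp add: measure_def)
    moreover have "prob {\<omega> \<in> space M. card (\<Phi> \<omega> \<inter> ?B) = 0} =
        (lam * measure lborel ?B) ^ 0 / fact 0 * exp (- (lam * measure lborel ?B))"
      using PPP B unfolding homogeneous_PPP_def by blast
    ultimately have "prob {\<omega> \<in> space M. card (\<Phi> \<omega> \<inter> ?B) = 0} = 1"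
      by simp
    then have "AE \<omega> in M. \<omega> \<in> {\<omega> \<in> space M. card (\<Phi> \<omega> \<inter> ?B) = 0}"
      by (rule AE_prob_1)
    then show ?thesis
      by (rule eventually_mono) blast
  qed
  then have "AE \<omega> in M. \<forall>m. card (\<Phi> \<omega> \<inter> (A \<inter> ball 0 (real m))) = 0"
    by (simp add: AE_all_countable)
  \<comment> \<open>\<open>card\<close> is 0 on infinite sets as well; local finiteness is what
    turns count 0 into emptiness.\<close>
  moreover have "AE \<omega> in M. \<forall>B. bounded B \<longrightarrow> finite (\<Phi> \<omega> \<inter> B)"
    using PPP unfolding homogeneous_PPP_def by blast
  ultimately show ?thesis
  proof eventually_elim
    case (elim \<omega>)
    have "x \<notin> A" if "x \<in> \<Phi> \<omega>" for x
    proof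
      assume "x \<in> A"
      obtain m where "norm x < real m"
        using reals_Archimedean2 by blast
      then have "x \<in> \<Phi> \<omega> \<inter> (A \<inter> ball 0 (real m))"
        using that \<open>x \<in> A\<close> by simp
      moreover have "finite (\<Phi> \<omega> \<inter> (A \<inter> ball 0 (real m)))"
        using elim(2) by (meson bounded_Int bounded_ball)
      ultimately show False
        using elim(1) by (metis card_0_eq empty_iff)
    qed
    then show ?case
      by auto
  qed
qed

text \<open>Almost surely no base station at all has its distance in N, so neither does the serving
  one, however it is selected.\<close>

lemma AE_serving_distance_notin_null:
  assumes W: "is_network M P W" and N: "N \<in> null_sets lborel"
  shows "AE \<omega> in M. serving_distance P W \<omega> \<notin> N"
  using prob_space.homogeneous_PPP_AE_avoids_null[OF is_networkD(1,2)[OF W] null_sets_norm_vimage[OF N]]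
  by eventually_elim (auto simp: serving_distance_def)

lemma AE_serving_distance_pos:
  assumes W: "is_network M P W"
  shows "AE \<omega> in M. 0 < serving_distance P W \<omega>"
proof -
  have "{0::real} \<in> null_sets lborel"
    by (simp add: null_sets_def)
  from AE_serving_distance_notin_null[OF W this] show ?thesis
    by eventually_elim (simp add: serving_distance_def)
qed

text \<open>For each base station a LOS user link longer than D has probability 0, and there are
  countably many of them. This is why the LOS integral stops at D.\<close>

lemma AE_LOS_serving_distance:
  assumes P: "valid_params P" and W: "is_network M P W"
  shows "AE \<omega> in M. serving_state P W \<omega> = LOS \<longrightarrow> serving_distance P W \<omega> \<le> los_radius P"
proof -
  interpret prob_space M
    by (rule is_networkD(1)[OF W])
  note [measurable] = measurable_network[OF W]
  have "AE \<omega> in M. \<not> (norm (bs W n \<omega>) > los_radius P \<and> state W (User_Link n) \<omega> = LOS)" for n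
  proof -
    let ?A = "{xz \<in> space (config_space \<Otimes>\<^sub>M config_space). link_length xz (User_Link n) > los_radius P}"
    have A: "?A \<in> sets (config_space \<Otimes>\<^sub>M config_space)"
      by measurable
    have "emeasure M {\<omega> \<in> space M. locations W \<omega> \<in> ?A \<and> (\<forall>l\<in>{User_Link n}. state W l \<omega> \<in> {LOS})} =
        (\<integral>\<^sup>+\<omega>. indicator ?A (locations W \<omega>) *
          (\<Prod>l\<in>{User_Link n}. emeasure (link_state_law P (link_length (locations W \<omega>) l)) {LOS}) \<partial>M)"
    proof -
      have "\<forall>A \<in> sets (config_space \<Otimes>\<^sub>M config_space). \<forall>J B. finite J \<longrightarrow> (\<forall>j\<in>J. B j \<in> sets (count_space UNIV)) \<longrightarrow>
          emeasure M {\<omega> \<in> space M. locations W \<omega> \<in> A \<and> (\<forall>j\<in>J. state W j \<omega> \<in> B j)} =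
          (\<integral>\<^sup>+\<omega>. indicator A (locations W \<omega>) *
            (\<Prod>j\<in>J. emeasure (link_state_law P (link_length (locations W \<omega>) j)) (B j)) \<partial>M)"
        using is_networkD(6)[OF W] unfolding cond_indep_laws_def by (elim conjE)
      from this[rule_format, OF A, of "{User_Link n}" "\<lambda>_. {LOS}"] show ?thesis
        by simp
    qed
    also have "\<dots> = (\<integral>\<^sup>+\<omega>. 0 \<partial>M)"
    proof (intro nn_integral_cong)
      fix \<omega>
      have "emeasure (link_state_law P r) {LOS} = ennreal (los_prob P r)" for r
        using nn_integral_link_state_law[OF P, where f = "indicator {LOS}" and r = r] by simp
      then show "indicator ?A (locations W \<omega>) *
          (\<Prod>l\<in>{User_Link n}. emeasure (link_state_law P (link_length (locations W \<omega>) l)) {LOS}) = 0"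
        by (auto simp: los_prob_def indicator_def)
    qed
    finally have "emeasure M {\<omega> \<in> space M. locations W \<omega> \<in> ?A \<and> (\<forall>l\<in>{User_Link n}. state W l \<omega> \<in> {LOS})} = 0"
      by simp
    moreover have "{\<omega> \<in> space M. locations W \<omega> \<in> ?A \<and> (\<forall>l\<in>{User_Link n}. state W l \<omega> \<in> {LOS})} =
        {\<omega> \<in> space M. \<not> \<not> (norm (bs W n \<omega>) > los_radius P \<and> state W (User_Link n) \<omega> = LOS)}"
      using measurable_space[OF measurable_locations[OF W]]
      by (auto simp: link_length_def locations_def)
    ultimately show ?thesis
      by (subst AE_iff_measurable[OF _ refl]) auto
  qed
  then have "AE \<omega> in M. \<forall>n. \<not> (norm (bs W n \<omega>) > los_radius P \<and> state W (User_Link n) \<omega> = LOS)"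
    by (simp add: AE_all_countable)
  then show ?thesis
    by eventually_elim (auto simp: serving_state_def serving_distance_def not_less)
qed

text \<open>The conditional law of the serving distance is absolutely continuous, so integrals
  against it are integrals against its Radon-Nikodym density, and a set R carrying the law may serve
  as domain. Nonnegativity is stated separately because \<open>ennreal\<close> sends negative
  numbers to 0, and the two association terms are finally added as reals.\<close>

lemma nn_integral_serving_distance:
  assumes W: "is_network M P W"
    and G[measurable]: "G \<in> borel_measurable borel" and G01: "\<And>r. 0 \<le> G r" "\<And>r. G r \<le> 1"
    and R[measurable]: "R \<in> sets borel"
    and AE_R: "AE \<omega> in M. serving_state P W \<omega> = j \<longrightarrow> serving_distance P W \<omega> \<in> R"
  shows "(\<integral>\<^sup>+\<omega>. indicator {\<omega>\<in>space M. serving_state P W \<omega> = j} \<omega> * ennreal (G (serving_distance P W \<omega>)) \<partial>M) =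
    ennreal (assoc_prob M P W j * (LBINT r:R. G r * serving_distance_density M P W j r))" (is "?lhs = _")
    and "0 \<le> assoc_prob M P W j * (LBINT r:R. G r * serving_distance_density M P W j r)"
proof -
  interpret prob_space M
    by (rule is_networkD(1)[OF W])
  note [measurable] = measurable_network[OF W]
  let ?S = "{\<omega>\<in>space M. serving_state P W \<omega> = j}"
  have S[measurable]: "?S \<in> sets M"
    by measurable
  show "0 \<le> assoc_prob M P W j * (LBINT r:R. G r * serving_distance_density M P W j r)"
    unfolding assoc_prob_def set_lebesgue_integral_def serving_distance_density_def
    using G01 by (intro mult_nonneg_nonneg integral_nonneg_AE) auto
  show "?lhs = ennreal (assoc_prob M P W j * (LBINT r:R. G r * serving_distance_density M P W j r))"
  proof (cases "prob ?S = 0")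
    \<comment> \<open>Conditioning on a null event gives no meaningful density, but the factor
      \<open>assoc_prob\<close> is 0 and makes the term vanish.\<close>
    case True
    then have "AE \<omega> in M. \<omega> \<notin> ?S"
      using prob_eq_0 S by blast
    then have "?lhs = (\<integral>\<^sup>+\<omega>. 0 \<partial>M)"
      by (intro nn_integral_cong_AE) (auto elim!: eventually_mono simp: indicator_def)
    then show ?thesis
      using True by (simp add: assoc_prob_def)
  next
    case False
    then have S0: "emeasure M ?S \<noteq> 0" "emeasure M ?S \<noteq> \<infinity>"
      by (simp_all add: emeasure_eq_measure)
    let ?U = "uniform_measure M ?S"
    let ?D = "distr ?U borel (serving_distance P W)"
    let ?f = "RN_deriv lborel ?D"
    interpret U: prob_space ?U
      by (rule prob_space_uniform_measure[OF S0])
    interpret D: prob_space ?D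
      by (rule U.prob_space_distr) simp
    have AE_U: "AE \<omega> in ?U. Q \<omega>" if "AE \<omega> in M. \<omega> \<in> ?S \<longrightarrow> Q \<omega>" for Q
      using that by (intro AE_uniform_measureI) auto
    have ac: "absolutely_continuous lborel ?D"
      unfolding absolutely_continuous_def
    proof
      fix N :: "real set" assume N: "N \<in> null_sets lborel"
      then have [measurable]: "N \<in> sets borel"
        by auto
      have "AE \<omega> in ?U. serving_distance P W \<omega> \<notin> N"
        using AE_serving_distance_notin_null[OF W N] by (intro AE_U) auto
      then have "AE r in ?D. r \<notin> N"
        by (subst AE_distr_iff) auto
      then show "N \<in> null_sets ?D"
        by (simp add: AE_iff_null_sets)
    qed
    \<comment> \<open>Since the density is finite almost everywhere, the \<open>enn2real\<close> in
      \<open>serving_distance_density\<close> loses nothing.\<close>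
    have fin: "AE r in lborel. ?f r \<noteq> \<infinity>"
      using ac D.sigma_finite_measure_axioms by (intro sigma_finite_measure.RN_deriv_finite[OF lborel.sigma_finite_measure_axioms]) auto
    have "AE \<omega> in ?U. serving_distance P W \<omega> \<in> R"
      using AE_R by (intro AE_U) auto
    then have D_R: "AE r in ?D. r \<in> R"
      by (subst AE_distr_iff) auto
    have "(\<integral>\<^sup>+r. ennreal (G r) \<partial>?D) = (\<integral>\<^sup>+\<omega>. ennreal (G (serving_distance P W \<omega>)) \<partial>?U)"
      by (rule nn_integral_distr) auto
    also have "\<dots> = (\<integral>\<^sup>+\<omega>. ennreal (G (serving_distance P W \<omega>)) * indicator ?S \<omega> \<partial>M) / emeasure M ?S"
      by (rule nn_integral_uniform_measure) auto
    also have "\<dots> = ?lhs / emeasure M ?S"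
      by (simp add: mult.commute)
    finally have lhs: "?lhs = emeasure M ?S * (\<integral>\<^sup>+r. ennreal (G r) \<partial>?D)"
      using S0 ennreal_mult_divide_eq[of "emeasure M ?S" ?lhs] by (simp add: ennreal_times_divide mult.commute[of "emeasure M ?S"])
    have "(\<integral>\<^sup>+r. ennreal (G r) \<partial>?D) = (\<integral>\<^sup>+r. indicator R r * ennreal (G r) \<partial>?D)"
      using D_R by (intro nn_integral_cong_AE) (auto elim!: eventually_mono)
    also have "\<dots> = (\<integral>\<^sup>+r. ?f r * (indicator R r * ennreal (G r)) \<partial>lborel)"
      using ac by (intro sigma_finite_measure.RN_deriv_nn_integral[OF lborel.sigma_finite_measure_axioms]) auto
    also have "\<dots> = (\<integral>\<^sup>+r. ennreal (indicator R r *\<^sub>R (G r * serving_distance_density M P W j r)) \<partial>lborel)"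
      using fin
      by (intro nn_integral_cong_AE, eventually_elim)
        (auto simp: serving_distance_density_def indicator_def ennreal_mult' G01 ennreal_enn2real_if mult.commute)
    finally have eq: "(\<integral>\<^sup>+r. ennreal (G r) \<partial>?D) =
        (\<integral>\<^sup>+r. ennreal (indicator R r *\<^sub>R (G r * serving_distance_density M P W j r)) \<partial>lborel)" .
    have "(\<integral>\<^sup>+r. ennreal (G r) \<partial>?D) \<le> (\<integral>\<^sup>+r. 1 \<partial>?D)"
      using G01 by (intro nn_integral_mono) simp
    then have le: "(\<integral>\<^sup>+r. ennreal (G r) \<partial>?D) < \<infinity>"
      using D.emeasure_space_1 by (auto simp: less_top[symmetric] top_unique)
    have "(LBINT r:R. G r * serving_distance_density M P W j r) = enn2real (\<integral>\<^sup>+r. ennreal (G r) \<partial>?D)"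
      unfolding set_lebesgue_integral_def eq serving_distance_density_def
      using G01 by (intro integral_eq_nn_integral) auto
    then have "(\<integral>\<^sup>+r. ennreal (G r) \<partial>?D) = ennreal (LBINT r:R. G r * serving_distance_density M P W j r)"
      using le by simp
    then show ?thesis
      unfolding lhs by (simp add: assoc_prob_def emeasure_eq_measure ennreal_mult')
  qed
qed

text \<open>\<open>y j r\<close> is the fading gain at which the user's SNR reaches T, so the
  conditional probability of connection is the gamma tail \<open>G j r\<close>. Splitting by the
  state of the serving link leaves one integral for each state.\<close>

lemma connection_prob_eq:
  assumes P: "valid_params P" and W: "is_network M P W" and T: "0 < T"
  defines "y \<equiv> \<lambda>j r. noise_power P * T * r powr pl_exponent P j / (tx_power P * array_gain P Main * pl_const P j)"
  defines "G \<equiv> \<lambda>j r. upper_Gamma (real (fading_shape P j)) (y j r) / Gamma (real (fading_shape P j))"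
  shows "connection_prob M P W T =
    assoc_prob M P W LOS * (LBINT r:{0..los_radius P}. G LOS r * serving_distance_density M P W LOS r) +
    assoc_prob M P W NLOS * (LBINT r:{0..}. G NLOS r * serving_distance_density M P W NLOS r)"
proof -
  interpret prob_space M
    by (rule is_networkD(1)[OF W])
  note [measurable] = measurable_network[OF W]
  note pos = valid_paramsD[OF P]
  have y0: "0 \<le> y j r" for j r
    using pos T by (simp add: y_def less_imp_le)
  have G_eq: "G j r = erlang_tail (fading_shape P j) (y j r)" for j r
    unfolding G_def by (rule upper_Gamma_eq_erlang_tail[OF pos(9) y0])
  have Gm[measurable]: "G j \<in> borel_measurable borel" for j
    unfolding G_eq[abs_def] y_def by measurable
  have G01: "0 \<le> G j r" "G j r \<le> 1" for j r
    unfolding G_eq using erlang_tail_bounds[OF pos(9) y0] by auto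
  let ?N = "(config_space \<Otimes>\<^sub>M config_space) \<Otimes>\<^sub>M state_space"
  let ?n = "\<lambda>w. serving_index P (fst w) (snd w)"
  let ?w = "\<lambda>\<omega>. (locations W \<omega>, states W \<omega>)"
  define b where "b w = tx_power P * array_gain P Main *
      path_loss P (snd w (User_Link (?n w))) (norm (fst (fst w) (?n w)))"
    for w :: "((nat \<Rightarrow> real^2) \<times> (nat \<Rightarrow> real^2)) \<times> (link \<Rightarrow> link_state)"
  have i: "?n \<in> ?N \<rightarrow>\<^sub>M count_space UNIV"
    using measurable_serving_index[of P] by (simp add: case_prod_unfold)
  have st: "(\<lambda>w. snd w (User_Link (?n w))) \<in> ?N \<rightarrow>\<^sub>M count_space UNIV"
    by (rule measurable_compose_countable[OF _ i]) measurable
  have nm: "(\<lambda>w. norm (fst (fst w) (?n w))) \<in> borel_measurable ?N"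
    by (rule measurable_compose_countable[OF _ i]) measurable
  have bm[measurable]: "b \<in> borel_measurable ?N"
    unfolding b_def[abs_def] using st nm by measurable
  have SNR: "SNR_user P W \<omega> = b (?w \<omega>) * gain W User_Fading \<omega> / noise_power P" for \<omega>
    by (simp add: SNR_user_def b_def serving_state_def serving_distance_def serving_def locations_def states_def)
  have wm[measurable]: "?w \<in> M \<rightarrow>\<^sub>M ?N"
    using is_networkD(7)[OF W] by (simp add: cond_indep_laws_def)
  have SNRm[measurable]: "SNR_user P W \<in> borel_measurable M"
    unfolding SNR using measurable_compose[OF wm bm] by measurable
  have "ennreal (connection_prob M P W T) = (\<integral>\<^sup>+\<omega>. indicator {\<omega>\<in>space M. SNR_user P W \<omega> \<ge> T} \<omega> \<partial>M)"
    by (simp add: connection_prob_def emeasure_eq_measure)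
  also have "\<dots> = (\<integral>\<^sup>+\<omega>. (\<lambda>w g. indicator {T..} (b w * g User_Fading / noise_power P)) (?w \<omega>) (\<lambda>i. gain W i \<omega>) \<partial>M)"
    by (intro nn_integral_cong) (auto simp: SNR indicator_def)
  also have "\<dots> = (\<integral>\<^sup>+\<omega>. (\<integral>\<^sup>+g. indicator {T..} (b (?w \<omega>) * g User_Fading / noise_power P) \<partial>PiM UNIV (\<lambda>i. gain_law P i (?w \<omega>))) \<partial>M)"
    by (rule cond_indep_laws_nn_integral[OF is_networkD(1)[OF W] is_networkD(7)[OF W] measurable_gain_law[OF P]])
      measurable
  also have "\<dots> = (\<integral>\<^sup>+\<omega>. ennreal (G (serving_state P W \<omega>) (serving_distance P W \<omega>)) \<partial>M)"
  proof (intro nn_integral_cong_AE)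
    \<comment> \<open>Distance 0 has probability 0; there \<open>0 powr (- a) = 0\<close> would
      invalidate the threshold on the gain.\<close>
    show "AE \<omega> in M. (\<integral>\<^sup>+g. indicator {T..} (b (?w \<omega>) * g User_Fading / noise_power P) \<partial>PiM UNIV (\<lambda>i. gain_law P i (?w \<omega>))) =
        ennreal (G (serving_state P W \<omega>) (serving_distance P W \<omega>))"
      using AE_serving_distance_pos[OF W]
    proof eventually_elim
      case (elim \<omega>)
      define j where "j = serving_state P W \<omega>"
      define r where "r = serving_distance P W \<omega>"
      have b: "b (?w \<omega>) = tx_power P * array_gain P Main * path_loss P j r"
        by (simp add: b_def j_def r_def serving_state_def serving_distance_def serving_def locations_def states_def)
      have law: "gain_law P User_Fading (?w \<omega>) = gamma_law (real (fading_shape P j))"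
        by (simp add: j_def serving_state_def serving_def states_def)
      have "indicator {T..} (b (?w \<omega>) * g / noise_power P) = (indicator {y j r..} g :: ennreal)" for g
      proof -
        define d where "d = tx_power P * array_gain P Main * pl_const P j"
        have d: "0 < d"
          using pos by (simp add: d_def)
        have "b (?w \<omega>) * g / noise_power P = d * g / (r powr pl_exponent P j * noise_power P)"
          using elim by (simp add: b path_loss_def d_def powr_minus divide_simps)
        moreover have "y j r = r powr pl_exponent P j * T * noise_power P / d"
          by (simp add: y_def d_def mult_ac)
        ultimately show ?thesis
          using pos(2) elim d by (simp add: indicator_def divide_le_eq le_divide_eq mult_ac r_def)
      qed
      \<comment> \<open>Written as a product over a one-element set, so that the formula for
        products of coordinates applies.\<close>
      then have "(\<integral>\<^sup>+g. indicator {T..} (b (?w \<omega>) * g User_Fading / noise_power P) \<partial>PiM UNIV (\<lambda>i. gain_law P i (?w \<omega>))) =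
          (\<integral>\<^sup>+g. (\<Prod>k\<in>{()}. (\<lambda>_. indicator {y j r..}) k (g ((\<lambda>_. User_Fading) k))) \<partial>PiM UNIV (\<lambda>i. gain_law P i (?w \<omega>)))"
        by simp
      also have "\<dots> = (\<Prod>k\<in>{()}. \<integral>\<^sup>+g. indicator {y j r..} g \<partial>gain_law P User_Fading (?w \<omega>))"
        by (rule nn_integral_PiM_prod[OF prob_space_gain_law(1)[OF P]])
          (auto simp: measurable_cong_sets[OF prob_space_gain_law(2)[OF P] refl])
      also have "\<dots> = ennreal (G j r)"
        using emeasure_gamma_law_atLeast[OF pos(9) y0] by (simp add: law G_def del: gain_law.simps)
      finally show ?case
        by (simp only: j_def r_def)
    qed
  qed
  also have "\<dots> = (\<integral>\<^sup>+\<omega>. indicator {\<omega>\<in>space M. serving_state P W \<omega> = LOS} \<omega> * ennreal (G LOS (serving_distance P W \<omega>)) +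
      indicator {\<omega>\<in>space M. serving_state P W \<omega> = NLOS} \<omega> * ennreal (G NLOS (serving_distance P W \<omega>)) \<partial>M)"
  proof (intro nn_integral_cong)
    fix \<omega> assume "\<omega> \<in> space M"
    then show "ennreal (G (serving_state P W \<omega>) (serving_distance P W \<omega>)) =
        indicator {\<omega>\<in>space M. serving_state P W \<omega> = LOS} \<omega> * ennreal (G LOS (serving_distance P W \<omega>)) +
        indicator {\<omega>\<in>space M. serving_state P W \<omega> = NLOS} \<omega> * ennreal (G NLOS (serving_distance P W \<omega>))"
      by (cases "serving_state P W \<omega>") auto
  qed
  also have "\<dots> = (\<integral>\<^sup>+\<omega>. indicator {\<omega>\<in>space M. serving_state P W \<omega> = LOS} \<omega> * ennreal (G LOS (serving_distance P W \<omega>)) \<partial>M) +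
      (\<integral>\<^sup>+\<omega>. indicator {\<omega>\<in>space M. serving_state P W \<omega> = NLOS} \<omega> * ennreal (G NLOS (serving_distance P W \<omega>)) \<partial>M)"
    by (intro nn_integral_add) measurable
  also have "\<dots> = ennreal (assoc_prob M P W LOS * (LBINT r:{0..los_radius P}. G LOS r * serving_distance_density M P W LOS r)) +
      ennreal (assoc_prob M P W NLOS * (LBINT r:{0..}. G NLOS r * serving_distance_density M P W NLOS r))"
    using AE_LOS_serving_distance[OF P W]
    by (intro arg_cong2[where f = "(+)"] nn_integral_serving_distance(1)[OF W Gm G01])
      (auto simp: serving_distance_def elim!: eventually_mono)
  finally have "ennreal (connection_prob M P W T) = \<dots>" .
  moreover have "0 \<le> assoc_prob M P W LOS * (LBINT r:{0..los_radius P}. G LOS r * serving_distance_density M P W LOS r)"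
    using AE_LOS_serving_distance[OF P W]
    by (intro nn_integral_serving_distance(2)[OF W Gm G01]) (auto simp: serving_distance_def elim!: eventually_mono)
  moreover have "0 \<le> assoc_prob M P W NLOS * (LBINT r:{0..}. G NLOS r * serving_distance_density M P W NLOS r)"
    by (intro nn_integral_serving_distance(2)[OF W Gm G01]) (auto simp: serving_distance_def)
  ultimately show ?thesis
    by (simp add: connection_prob_def flip: ennreal_plus)
qed

text \<open>\<open>SNR_eve\<close> contains the transmit power, so for general power the argument of
  \<open>Lambda_E\<close> is P_t / (T_e N_0). The argument 1 / (T_e N_0) belongs to power normalised
  to 1, which the last conjunct records.\<close>

theorem theorem2:
  fixes M :: "'w measure" and P :: network_params and W :: "'w network"
    and R_b R_s R_e T_c T_e :: real
  assumes "valid_params P"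
    and "is_network M P W"
    and "0 \<le> R_s" and "R_s < R_b"
    and "R_e = R_b - R_s"
    and "T_c = 2 powr R_b - 1"
    and "T_e = 2 powr R_e - 1"
  shows "connection_prob M P W T_c =
      assoc_prob M P W LOS *
        (LBINT r:{0..los_radius P}.
           upper_Gamma (real (fading_shape P LOS))
             (noise_power P * T_c * r powr pl_exponent P LOS /
              (tx_power P * array_gain P Main * pl_const P LOS)) /
           Gamma (real (fading_shape P LOS)) *
           serving_distance_density M P W LOS r) +
      assoc_prob M P W NLOS *
        (LBINT r:{0..}.
           upper_Gamma (real (fading_shape P NLOS))
             (noise_power P * T_c * r powr pl_exponent P NLOS /
              (tx_power P * array_gain P Main * pl_const P NLOS)) /
           Gamma (real (fading_shape P NLOS)) *
           serving_distance_density M P W NLOS r)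
    \<and> secrecy_prob M P W T_e = exp (- Lambda_E P (tx_power P / (T_e * noise_power P)))
    \<and> (tx_power P = 1 \<longrightarrow>
        secrecy_prob M P W T_e = exp (- Lambda_E P (1 / (T_e * noise_power P))))"
proof -
  \<comment> \<open>Both exponents are positive: R_b > R_s \<ge> 0, and R_e = R_b - R_s > 0.\<close>
  have "0 < T_c" "0 < T_e"
    using assms(3-7) by (auto intro!: gr_one_powr)
  note C = connection_prob_eq[OF assms(1,2) this(1)] and S = secrecy_prob_eq[OF assms(1,2) this(2)]
  show ?thesis
  proof (intro conjI impI)
    show "secrecy_prob M P W T_e = exp (- Lambda_E P (1 / (T_e * noise_power P)))" if "tx_power P = 1"
      using S that by simp
  qed (rule C S)+
qed

end
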